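(* Let $K \subset L$ be a commutative field extension in which every element of $L$ that is algebraic over $K$ is separable over $K$. Then, for all positive integers $r,s \le \dim_K L$, we have $\mu_{K,L}(r,s) = \kappa_{K,L}(r,s)$.
   Context: For $K$-subspaces $A,B$ of $L$, $\langle AB\rangle$ denotes the $K$-subspace of $L$ spanned by the product set $AB=\{ab \mid a\in A, b\in B\}$. For positive integers $r,s \le \dim_K L$, $\mu_{K,L}(r,s)$ is the minimum of $\dim_K \langle AB\rangle$ over all $K$-subspaces $A,B$ of $L$ with $\dim_K A = r$ and $\dim_K B = s$. The function $\kappa_{K,L}(r,s) = \min_h (\lceil r/h\rceil + \lceil s/h\rceil - 1)h$, where $h=[H:K]$ runs over the set of $K$-dimensions of all finite-dimensional intermediate fields $K \subset H \subset L$. *)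

theory Defs
  imports "HOL-Computational_Algebra.Polynomial" "HOL-Library.Extended_Nat"
begin

text \<open>The big field L is the type 'a (a commutative field); the small field K is a
  subfield of it, given as a subset of 'a.\<close>

definition subfield_of :: "'a::field set \<Rightarrow> bool" where
  "subfield_of K \<longleftrightarrow> 0 \<in> K \<and> 1 \<in> K \<and>
     (\<forall>x\<in>K. \<forall>y\<in>K. x + y \<in> K \<and> x * y \<in> K) \<and>
     (\<forall>x\<in>K. - x \<in> K \<and> inverse x \<in> K)"

definition K_subspace :: "'a::field set \<Rightarrow> 'a set \<Rightarrow> bool" where
  "K_subspace K A \<longleftrightarrow> 0 \<in> A \<and> (\<forall>x\<in>A. \<forall>y\<in>A. x + y \<in> A) \<and>
     (\<forall>c\<in>K. \<forall>x\<in>A. c * x \<in> A)"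

definition K_span :: "'a::field set \<Rightarrow> 'a set \<Rightarrow> 'a set" where
  "K_span K S = {(\<Sum>x\<in>F. c x * x) | F c. finite F \<and> F \<subseteq> S \<and> (\<forall>x\<in>F. c x \<in> K)}"

definition K_independent :: "'a::field set \<Rightarrow> 'a set \<Rightarrow> bool" where
  "K_independent K S \<longleftrightarrow> (\<forall>F c. finite F \<and> F \<subseteq> S \<and> (\<forall>x\<in>F. c x \<in> K) \<and>
       (\<Sum>x\<in>F. c x * x) = 0 \<longrightarrow> (\<forall>x\<in>F. c x = 0))"

definition K_basis :: "'a::field set \<Rightarrow> 'a set \<Rightarrow> 'a set \<Rightarrow> bool" where
  "K_basis K A B \<longleftrightarrow> B \<subseteq> A \<and> K_independent K B \<and> K_span K B = A"

definition K_dim :: "'a::field set \<Rightarrow> 'a set \<Rightarrow> enat" where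
  "K_dim K A = (if \<exists>B. finite B \<and> K_basis K A B
                then enat (card (SOME B. finite B \<and> K_basis K A B)) else \<infinity>)"

definition prod_span :: "'a::field set \<Rightarrow> 'a set \<Rightarrow> 'a set \<Rightarrow> 'a set" where
  "prod_span K A B = K_span K {a * b | a b. a \<in> A \<and> b \<in> B}"

definition mu :: "'a::field set \<Rightarrow> nat \<Rightarrow> nat \<Rightarrow> enat" where
  "mu K r s = Inf {K_dim K (prod_span K A B) | A B.
       K_subspace K A \<and> K_subspace K B \<and> K_dim K A = enat r \<and> K_dim K B = enat s}"

definition intermediate_degrees :: "'a::field set \<Rightarrow> nat set" where
  "intermediate_degrees K = {h. \<exists>H. subfield_of H \<and> K \<subseteq> H \<and> K_dim K H = enat h}"

definition kappa :: "'a::field set \<Rightarrow> nat \<Rightarrow> nat \<Rightarrow> nat" where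
  "kappa K r s = Inf ((\<lambda>h. ((r + h - 1) div h + (s + h - 1) div h - 1) * h)
                        ` intermediate_degrees K)"

definition K_algebraic :: "'a::field set \<Rightarrow> 'a \<Rightarrow> bool" where
  "K_algebraic K x \<longleftrightarrow> (\<exists>p. p \<noteq> 0 \<and> (\<forall>i. coeff p i \<in> K) \<and> poly p x = 0)"

definition K_min_poly :: "'a::field set \<Rightarrow> 'a \<Rightarrow> 'a poly \<Rightarrow> bool" where
  "K_min_poly K x p \<longleftrightarrow> lead_coeff p = 1 \<and> (\<forall>i. coeff p i \<in> K) \<and> poly p x = 0 \<and>
     (\<forall>q. q \<noteq> 0 \<and> (\<forall>i. coeff q i \<in> K) \<and> poly q x = 0 \<longrightarrow> degree p \<le> degree q)"

definition K_separable :: "'a::field set \<Rightarrow> 'a \<Rightarrow> bool" where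
  "K_separable K x \<longleftrightarrow> K_algebraic K x \<and>
     (\<forall>p. K_min_poly K x p \<longrightarrow> coprime p (pderiv p))"

end

theory Submission
  imports Defs "HOL-Computational_Algebra.Formal_Laurent_Series"
begin

text \<open>
  The lower bound is the linear version of Kneser's theorem:
  \<open>dim A + dim B \<le> dim \<langle>AB\<rangle> + dim (stab \<langle>AB\<rangle>)\<close>. A Dyson transform yields, for every nonzero \<open>a \<in> A\<close>, a
  subspace \<open>a B \<subseteq> V \<subseteq> \<langle>AB\<rangle>\<close> stable under a subfield \<open>H\<close> with \<open>dim A + dim B \<le> dim V + dim H\<close>. If \<open>K\<close> is infinite
  and only finitely many subfields \<open>H\<close> occur, some \<open>H\<close> occurs for a spanning set of elements \<open>a\<close> and hence
  stabilizes \<open>\<langle>AB\<rangle>\<close>. To treat all \<open>K\<close> uniformly, this is applied to the Laurent series fields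
  \<open>K((t)) \<subseteq> L((t))\<close>: all subfields that occur lie in \<open>K(\<theta>)((t))\<close> for a fixed algebraic \<open>\<theta>\<close>, and a simple extension has
  finitely many intermediate fields. The existence of such a \<open>\<theta>\<close>, as well as the upper bound, which uses the
  \<open>H\<close>-spans of \<open>1, \<theta>, \<theta>\<^sup>2, \<dots>\<close>, rests on the primitive element theorem; this is where separability enters.
\<close>

subsection \<open>Linear algebra over a subfield\<close>

text \<open>The Dyson transform yields a subfield \<open>H\<close> that depends on \<open>a\<close>.
  Pigeonholing onto a single \<open>H\<close> needs infinitely many \<open>a\<close> in general
  position against finitely many \<open>H\<close>. The first requirement fails over a finite
  \<open>K\<close> but always holds over K((t)). The inequality can be read back there: dimensions
  and product spans are unchanged under passing from A to A((t)), and the stabilizer of C((t)) lies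
  in the series over the stabilizer of C. The second requirement is the main obstacle: an
  \<open>H\<close> is only known to carry some nonzero v of C((t)) into C((t)), and v varies.
  Therefore K(\<theta>) is chosen so that C is contained in the span of as few elements as possible.
  Over such a field, an algebraic multiplier that takes one nonzero element of the span of C into
  that span is already a scalar. Comparing leading coefficients carries this over to series, so that
  the primitive element theorem is applied only to K inside L.\<close>

locale subfield =
  fixes K :: "'a::field set"
  assumes subfield: "subfield_of K"
begin

lemma zero_mem [simp]: "0 \<in> K" and one_mem [simp]: "1 \<in> K"
  using subfield by (auto simp: subfield_of_def)

lemma add_mem: "x \<in> K \<Longrightarrow> y \<in> K \<Longrightarrow> x + y \<in> K"
  and mult_mem: "x \<in> K \<Longrightarrow> y \<in> K \<Longrightarrow> x * y \<in> K"
  and uminus_mem: "x \<in> K \<Longrightarrow> - x \<in> K"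
  and inverse_mem: "x \<in> K \<Longrightarrow> inverse x \<in> K"
  using subfield by (auto simp: subfield_of_def)

lemma diff_mem: "x \<in> K \<Longrightarrow> y \<in> K \<Longrightarrow> x - y \<in> K"
  using add_mem[of x "- y"] uminus_mem by simp

lemma divide_mem: "x \<in> K \<Longrightarrow> y \<in> K \<Longrightarrow> x / y \<in> K"
  using mult_mem inverse_mem by (simp add: divide_inverse)

lemma power_mem: "x \<in> K \<Longrightarrow> x ^ n \<in> K"
  by (induction n) (auto intro: mult_mem)

lemma sum_mem: "(\<And>i. i \<in> I \<Longrightarrow> f i \<in> K) \<Longrightarrow> sum f I \<in> K"
  by (induction I rule: infinite_finite_induct) (auto intro: add_mem)

lemma subspaceD:
  assumes "K_subspace K A"
  shows subspace_zero: "0 \<in> A"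
    and subspace_add: "x \<in> A \<Longrightarrow> y \<in> A \<Longrightarrow> x + y \<in> A"
    and subspace_scale: "c \<in> K \<Longrightarrow> x \<in> A \<Longrightarrow> c * x \<in> A"
    and subspace_diff: "x \<in> A \<Longrightarrow> y \<in> A \<Longrightarrow> x - y \<in> A"
    and subspace_sum: "(\<And>i. i \<in> I \<Longrightarrow> f i \<in> A) \<Longrightarrow> sum f I \<in> A"
proof -
  show *: "0 \<in> A" "x \<in> A \<Longrightarrow> y \<in> A \<Longrightarrow> x + y \<in> A" "c \<in> K \<Longrightarrow> x \<in> A \<Longrightarrow> c * x \<in> A" for x y c
    using assms by (auto simp: K_subspace_def)
  show "x \<in> A \<Longrightarrow> y \<in> A \<Longrightarrow> x - y \<in> A" for x y
    using *(2)[of x "(-1) * y"] *(3)[of "-1" y] uminus_mem[of 1] by simp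
  show "(\<And>i. i \<in> I \<Longrightarrow> f i \<in> A) \<Longrightarrow> sum f I \<in> A"
    by (induction I rule: infinite_finite_induct) (auto intro: *)
qed

lemma subspace_cancel_scale:
  assumes "K_subspace K A" "c \<in> K" "c \<noteq> 0" "c * x \<in> A"
  shows "x \<in> A"
  using subspace_scale[OF assms(1), of "inverse c" "c * x"] assms inverse_mem
  by (simp flip: mult.assoc)

lemma subspace_bot: "K_subspace K {0}"
  by (auto simp: K_subspace_def)

lemma subspace_Int: "K_subspace K A \<Longrightarrow> K_subspace K B \<Longrightarrow> K_subspace K (A \<inter> B)"
  by (auto simp: K_subspace_def)

lemma subspace_sums:
  assumes "K_subspace K A" "K_subspace K B"
  shows "K_subspace K {a + b |a b. a \<in> A \<and> b \<in> B}"
  unfolding K_subspace_def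
proof (intro conjI ballI)
  show "0 \<in> {a + b |a b. a \<in> A \<and> b \<in> B}"
    using subspace_zero[OF assms(1)] subspace_zero[OF assms(2)] by force
next
  fix x y assume "x \<in> {a + b |a b. a \<in> A \<and> b \<in> B}" "y \<in> {a + b |a b. a \<in> A \<and> b \<in> B}"
  then obtain a b a' b' where "x = a + b" "y = a' + b'" "a \<in> A" "b \<in> B" "a' \<in> A" "b' \<in> B" by auto
  then have "x + y = (a + a') + (b + b')" "a + a' \<in> A" "b + b' \<in> B"
    using subspace_add assms by (auto simp: algebra_simps)
  then show "x + y \<in> {a + b |a b. a \<in> A \<and> b \<in> B}" by blast
next
  fix c x assume "c \<in> K" "x \<in> {a + b |a b. a \<in> A \<and> b \<in> B}"
  then obtain a b where "x = a + b" "a \<in> A" "b \<in> B" by auto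
  then have "c * x = c * a + c * b" "c * a \<in> A" "c * b \<in> B"
    using subspace_scale assms \<open>c \<in> K\<close> by (auto simp: distrib_left)
  then show "c * x \<in> {a + b |a b. a \<in> A \<and> b \<in> B}" by blast
qed

text \<open>Serves to prove inclusions between spans of products: with one factor fixed, the
  admissible other factors form a subspace, so that checking generators suffices.\<close>

lemma subspace_preimage_mult: "K_subspace K A \<Longrightarrow> K_subspace K {x. x * y \<in> A}"
  unfolding K_subspace_def by (auto simp: distrib_right mult.assoc)

lemma subspace_image_mult: "K_subspace K A \<Longrightarrow> K_subspace K ((*) y ` A)"
  unfolding K_subspace_def
  by (auto simp: image_iff simp flip: distrib_left)

lemma sum_extend_by_zero:
  fixes F G :: "'a set"
  assumes "finite F" "F \<subseteq> G" "finite G"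
  shows "(\<Sum>x\<in>F. c x * x) = (\<Sum>x\<in>G. (if x \<in> F then c x else 0) * x)"
  using assms by (intro sum.mono_neutral_cong_left) auto

lemma subspace_span: "K_subspace K (K_span K S)"
  unfolding K_subspace_def
proof (intro conjI ballI)
  show "0 \<in> K_span K S"
    unfolding K_span_def by (rule CollectI, rule exI[of _ "{}"]) auto
next
  fix x y assume "x \<in> K_span K S" "y \<in> K_span K S"
  then obtain F c G d where 1: "finite F" "F \<subseteq> S" "\<forall>x\<in>F. c x \<in> K" "x = (\<Sum>x\<in>F. c x * x)"
    and 2: "finite G" "G \<subseteq> S" "\<forall>x\<in>G. d x \<in> K" "y = (\<Sum>x\<in>G. d x * x)"
    unfolding K_span_def by blast
  let ?e = "\<lambda>x. (if x \<in> F then c x else 0) + (if x \<in> G then d x else 0)"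
  have "x + y = (\<Sum>x\<in>F \<union> G. ?e x * x)"
    using sum_extend_by_zero[OF 1(1), of "F \<union> G" c] sum_extend_by_zero[OF 2(1), of "F \<union> G" d] 1 2
    by (simp add: sum.distrib distrib_right)
  moreover have "\<forall>x\<in>F \<union> G. ?e x \<in> K" using 1 2 add_mem by auto
  ultimately show "x + y \<in> K_span K S"
    unfolding K_span_def using 1 2 by (intro CollectI exI[of _ "F \<union> G"] exI[of _ ?e]) auto
next
  fix k x assume "k \<in> K" "x \<in> K_span K S"
  then obtain F c where 1: "finite F" "F \<subseteq> S" "\<forall>x\<in>F. c x \<in> K" "x = (\<Sum>x\<in>F. c x * x)"
    unfolding K_span_def by blast
  then show "k * x \<in> K_span K S"
    unfolding K_span_def using mult_mem \<open>k \<in> K\<close>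
    by (intro CollectI exI[of _ "F"] exI[of _ "\<lambda>x. k * c x"])
       (auto simp: sum_distrib_left mult.assoc)
qed

lemma span_superset: "S \<subseteq> K_span K S"
proof
  fix x assume "x \<in> S"
  then show "x \<in> K_span K S"
    unfolding K_span_def by (intro CollectI exI[of _ "{x}"] exI[of _ "\<lambda>_. 1"]) auto
qed

lemma span_base: "x \<in> S \<Longrightarrow> x \<in> K_span K S"
  using span_superset by blast

lemma span_minimal: "K_subspace K A \<Longrightarrow> S \<subseteq> A \<Longrightarrow> K_span K S \<subseteq> A"
  unfolding K_span_def by (auto intro!: subspace_sum subspace_scale)

lemma span_mono: "S \<subseteq> T \<Longrightarrow> K_span K S \<subseteq> K_span K T"
  using span_minimal[OF subspace_span] span_superset by blast

lemma span_subset_span: "S \<subseteq> K_span K T \<Longrightarrow> K_span K S \<subseteq> K_span K T"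
  by (rule span_minimal[OF subspace_span])

lemma span_empty: "K_span K {} = {0}"
  using span_minimal[OF subspace_bot, of "{}"] subspace_zero[OF subspace_span] by auto

lemma span_insert: "K_span K (insert a S) = {k * a + x |k x. k \<in> K \<and> x \<in> K_span K S}"
  (is "_ = ?R")
proof
  have "K_subspace K ?R"
    unfolding K_subspace_def
  proof (intro conjI ballI)
    show "0 \<in> ?R" using subspace_zero[OF subspace_span, of S] by force
  next
    fix x y assume "x \<in> ?R" "y \<in> ?R"
    then obtain k u l v where "x = k * a + u" "y = l * a + v"
      "k \<in> K" "u \<in> K_span K S" "l \<in> K" "v \<in> K_span K S" by auto
    then have "x + y = (k + l) * a + (u + v)" "k + l \<in> K" "u + v \<in> K_span K S"
      using subspace_add[OF subspace_span] add_mem by (auto simp: algebra_simps)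
    then show "x + y \<in> ?R" by blast
  next
    fix c x assume "c \<in> K" "x \<in> ?R"
    then obtain k u where "x = k * a + u" "k \<in> K" "u \<in> K_span K S" by auto
    then have "c * x = (c * k) * a + c * u" "c * k \<in> K" "c * u \<in> K_span K S"
      using subspace_scale[OF subspace_span] mult_mem \<open>c \<in> K\<close> by (auto simp: algebra_simps)
    then show "c * x \<in> ?R" by blast
  qed
  moreover have "insert a S \<subseteq> ?R"
  proof -
    have "a = 1 * a + 0" "\<And>x. x = 0 * a + x" by auto
    then show ?thesis
      using subspace_zero[OF subspace_span, of S] span_base[of _ S] zero_mem one_mem by blast
  qed
  ultimately show "K_span K (insert a S) \<subseteq> ?R" by (rule span_minimal)
  show "?R \<subseteq> K_span K (insert a S)"
    using subspace_add[OF subspace_span] subspace_scale[OF subspace_span] span_base[of a "insert a S"]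
      span_mono[of S "insert a S"] by blast
qed

lemma span_Un: "K_span K (S \<union> T) = {x + y |x y. x \<in> K_span K S \<and> y \<in> K_span K T}"
  (is "_ = ?R")
proof
  have "S \<union> T \<subseteq> ?R"
  proof -
    have "x \<in> ?R" if "x \<in> S" for x
      using that span_base[of x S] subspace_zero[OF subspace_span, of T] by force
    moreover have "x \<in> ?R" if "x \<in> T" for x
      using that span_base[of x T] subspace_zero[OF subspace_span, of S] by force
    ultimately show ?thesis by blast
  qed
  then show "K_span K (S \<union> T) \<subseteq> ?R"
    by (intro span_minimal subspace_sums subspace_span)
  show "?R \<subseteq> K_span K (S \<union> T)"
    using span_mono[of S "S \<union> T"] span_mono[of T "S \<union> T"] subspace_add[OF subspace_span] by blast
qed

lemma span_image_mult: "K_span K ((*) y ` S) = (*) y ` K_span K S"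
proof
  show "K_span K ((*) y ` S) \<subseteq> (*) y ` K_span K S"
    using span_superset by (intro span_minimal subspace_image_mult subspace_span) auto
  have "K_span K S \<subseteq> {x. x * y \<in> K_span K ((*) y ` S)}"
    using span_superset[of "(*) y ` S"]
    by (intro span_minimal subspace_preimage_mult subspace_span) (auto simp: mult.commute[of _ y])
  then show "(*) y ` K_span K S \<subseteq> K_span K ((*) y ` S)" by (auto simp: mult.commute[of _ y])
qed

section \<open>Independence, exchange and bases\<close>

lemma independent_mono: "K_independent K T \<Longrightarrow> S \<subseteq> T \<Longrightarrow> K_independent K S"
  unfolding K_independent_def by blast

lemma independent_empty: "K_independent K {}"
  unfolding K_independent_def by auto

lemma independent_insert:
  assumes "a \<notin> S"
  shows "K_independent K (insert a S) \<longleftrightarrow> K_independent K S \<and> a \<notin> K_span K S"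
proof (intro iffI conjI)
  assume ind: "K_independent K (insert a S)"
  then show "K_independent K S" by (rule independent_mono) auto
  show "a \<notin> K_span K S"
  proof
    assume "a \<in> K_span K S"
    then obtain F c where F: "finite F" "F \<subseteq> S" "\<forall>x\<in>F. c x \<in> K" "a = (\<Sum>x\<in>F. c x * x)"
      unfolding K_span_def by blast
    let ?c = "\<lambda>x. if x = a then -1 else c x"
    have "a \<notin> F" using F assms by auto
    have "(\<Sum>x\<in>F. ?c x * x) = (\<Sum>x\<in>F. c x * x)"
      using \<open>a \<notin> F\<close> by (intro sum.cong) auto
    then have "(\<Sum>x\<in>insert a F. ?c x * x) = 0"
      using F(1) \<open>a \<notin> F\<close> by (simp flip: F(4))
    moreover have "\<forall>x\<in>insert a F. ?c x \<in> K" using F uminus_mem[of 1] by auto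
    ultimately have "?c a = 0"
      using ind[unfolded K_independent_def, rule_format, of "insert a F" ?c a] F by auto
    then show False by simp
  qed
next
  assume a: "K_independent K S \<and> a \<notin> K_span K S"
  show "K_independent K (insert a S)"
    unfolding K_independent_def
  proof (intro allI impI)
    fix F c assume F: "finite F \<and> F \<subseteq> insert a S \<and> (\<forall>x\<in>F. c x \<in> K) \<and> (\<Sum>x\<in>F. c x * x) = 0"
    show "\<forall>x\<in>F. c x = 0"
    proof (cases "a \<in> F")
      case False
      then have "F \<subseteq> S" using F by auto
      then show ?thesis
        using F a[THEN conjunct1, unfolded K_independent_def, rule_format, of F c] by blast
    next
      case True
      then have eq: "c a * a + (\<Sum>x\<in>F - {a}. c x * x) = 0"
        using F sum.remove[of F a "\<lambda>x. c x * x"] by simp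
      have sp: "(\<Sum>x\<in>F - {a}. c x * x) \<in> K_span K S"
        using F span_base[of _ S] by (intro subspace_sum subspace_scale subspace_span) auto
      have "c a = 0"
      proof (rule ccontr)
        assume "c a \<noteq> 0"
        have "0 - (\<Sum>x\<in>F - {a}. c x * x) \<in> K_span K S"
          using sp subspace_diff[OF subspace_span] subspace_zero[OF subspace_span] by blast
        then have "c a * a \<in> K_span K S" using eq by (simp add: add_eq_0_iff2)
        then show False
          using subspace_cancel_scale[OF subspace_span _ \<open>c a \<noteq> 0\<close>] F True a by blast
      qed
      moreover have "\<forall>x\<in>F - {a}. c x = 0"
        using a[THEN conjunct1, unfolded K_independent_def, rule_format, of "F - {a}" c]
          F eq \<open>c a = 0\<close> by auto
      ultimately show ?thesis by auto
    qed
  qed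
qed

text \<open>Elements of \<open>U\<close> are removed until \<open>i\<close> leaves the span; the
  element removed last has a nonzero coefficient in \<open>i\<close> and can be solved for. The set
  \<open>J\<close> is protected from the exchange.\<close>

lemma span_exchange:
  assumes "finite U" "i \<in> K_span K (J \<union> U)" "i \<notin> K_span K J"
  shows "\<exists>s\<in>U. s \<in> K_span K (insert i (J \<union> (U - {s})))"
  using assms
proof (induction U rule: finite_induct)
  case (insert u U)
  show ?case
  proof (cases "i \<in> K_span K (J \<union> U)")
    case True
    with insert obtain s where "s \<in> U" "s \<in> K_span K (insert i (J \<union> (U - {s})))" by blast
    then show ?thesis
      using span_mono[of "insert i (J \<union> (U - {s}))" "insert i (J \<union> (insert u U - {s}))"] by blast
  next
    case False
    obtain k x where k: "i = k * u + x" "k \<in> K" "x \<in> K_span K (J \<union> U)"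
      using insert.prems(1) span_insert[of u "J \<union> U"] by auto
    with False have "k \<noteq> 0" by auto
    let ?T = "insert i (J \<union> (insert u U - {u}))"
    have T: "?T = insert i (J \<union> U)" using insert.hyps by auto
    have "i - x \<in> K_span K ?T"
      unfolding T using k span_base[of i] span_mono[of "J \<union> U" "insert i (J \<union> U)"]
      by (intro subspace_diff subspace_span) auto
    then have "k * u \<in> K_span K ?T" using k by simp
    then have "u \<in> K_span K ?T" using subspace_cancel_scale[OF subspace_span k(2) \<open>k \<noteq> 0\<close>] by blast
    then show ?thesis by blast
  qed
qed simp

lemma steinitz:
  assumes "finite I" "K_independent K I" "I \<subseteq> K_span K S" "finite S"
  shows "card I \<le> card S"
proof -
  \<comment> \<open>\<open>T\<close> collects the elements of \<open>S\<close> already exchanged for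
    elements of \<open>I\<close>.\<close>
  have "\<exists>T\<subseteq>S. card T = card I \<and> S \<subseteq> K_span K (I \<union> (S - T))"
    using assms(1-3)
  proof (induction I rule: finite_induct)
    case empty
    then show ?case using span_superset by (intro exI[of _ "{}"]) auto
  next
    case (insert i I)
    then obtain T where T: "T \<subseteq> S" "card T = card I" "S \<subseteq> K_span K (I \<union> (S - T))"
      using independent_insert by auto
    have "i \<in> K_span K (I \<union> (S - T))"
      using insert.prems T(3) span_subset_span by blast
    moreover have "i \<notin> K_span K I" using insert independent_insert by blast
    ultimately obtain s where s: "s \<in> S - T" "s \<in> K_span K (insert i (I \<union> (S - T - {s})))"
      using span_exchange[of "S - T" i I] assms(4) by blast
    let ?T = "insert s T"
    have "I \<union> (S - T) \<subseteq> K_span K (insert i I \<union> (S - ?T))"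
    proof
      fix x assume "x \<in> I \<union> (S - T)"
      moreover have "insert i (I \<union> (S - T - {s})) = insert i I \<union> (S - ?T)" by auto
      ultimately show "x \<in> K_span K (insert i I \<union> (S - ?T))"
        using s(2) by (cases "x = s") (auto intro: span_base)
    qed
    then have "S \<subseteq> K_span K (insert i I \<union> (S - ?T))" using T(3) span_subset_span by blast
    moreover have "card ?T = card (insert i I)"
      using s T insert.hyps finite_subset[OF T(1) assms(4)] by simp
    ultimately show ?case using s T by (intro exI[of _ ?T]) auto
  qed
  then show ?thesis using card_mono[OF assms(4)] by metis
qed

text \<open>A largest independent set between \<open>J\<close> and \<open>A\<close> exists because
  \<open>steinitz\<close> bounds the cardinalities by \<open>card S\<close>; being largest, it
  spans.\<close>

lemma extend_basis:
  assumes "K_subspace K A" "A \<subseteq> K_span K S" "finite S" "J \<subseteq> A" "K_independent K J" "finite J"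
  obtains B where "finite B" "J \<subseteq> B" "K_basis K A B"
proof -
  define P where "P = (\<lambda>n. \<exists>B. finite B \<and> card B = n \<and> J \<subseteq> B \<and> B \<subseteq> A \<and> K_independent K B)"
  have "P (card J)" unfolding P_def using assms by blast
  moreover have "\<forall>n. P n \<longrightarrow> n \<le> card S"
    unfolding P_def using steinitz assms(2,3) by blast
  ultimately obtain n where n: "P n" "\<forall>m. P m \<longrightarrow> m \<le> n"
    using Nat.ex_has_greatest_nat[of P "card J" "card S"] by blast
  then obtain B where B: "finite B" "card B = n" "J \<subseteq> B" "B \<subseteq> A" "K_independent K B"
    unfolding P_def by blast
  have "A \<subseteq> K_span K B"
  proof
    fix a assume "a \<in> A"
    show "a \<in> K_span K B"
    proof (rule ccontr)
      assume a: "a \<notin> K_span K B"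
      then have "a \<notin> B" using span_base by blast
      with a B \<open>a \<in> A\<close> have "P (Suc n)"
        unfolding P_def using independent_insert[of a B]
        by (intro exI[of _ "insert a B"]) auto
      then show False using n by fastforce
    qed
  qed
  then have "K_basis K A B"
    unfolding K_basis_def using B span_minimal[OF assms(1) B(4)] by auto
  then show ?thesis using that B by blast
qed

lemma K_dim_eq_card:
  assumes "finite B" "K_basis K A B"
  shows "K_dim K A = enat (card B)"
proof -
  have "\<exists>B. finite B \<and> K_basis K A B" using assms by blast
  then have *: "finite (SOME B. finite B \<and> K_basis K A B) \<and> K_basis K A (SOME B. finite B \<and> K_basis K A B)"
    by (rule someI_ex)
  then have "card (SOME B. finite B \<and> K_basis K A B) = card B"
    using assms by (intro antisym steinitz) (auto simp: K_basis_def)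
  then show ?thesis unfolding K_dim_def using assms by auto
qed

end

section \<open>Finite-dimensional subspaces and their dimension\<close>

definition kdim :: "'a::field set \<Rightarrow> 'a set \<Rightarrow> nat" where
  "kdim K A = the_enat (K_dim K A)"

text \<open>The finite spanning set may lie outside \<open>A\<close>, which makes the notion
  hereditary for subspaces at once. It accompanies every use of \<open>kdim\<close>, whose value is
  unspecified in infinite dimension.\<close>

definition fin_dim :: "'a::field set \<Rightarrow> 'a set \<Rightarrow> bool" where
  "fin_dim K A \<longleftrightarrow> K_subspace K A \<and> (\<exists>S. finite S \<and> A \<subseteq> K_span K S)"

context subfield
begin

lemma fin_dim_subspace: "fin_dim K A \<Longrightarrow> K_subspace K A"
  by (simp add: fin_dim_def)

lemma kdim_eq_card: "finite B \<Longrightarrow> K_basis K A B \<Longrightarrow> kdim K A = card B"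
  by (simp add: kdim_def K_dim_eq_card)

lemma basis_exists:
  assumes "fin_dim K A"
  obtains B where "finite B" "K_basis K A B" "card B = kdim K A"
proof -
  obtain S where "K_subspace K A" "A \<subseteq> K_span K S" "finite S"
    using assms unfolding fin_dim_def by blast
  then obtain B where "finite B" "K_basis K A B"
    using extend_basis[of A S "{}"] independent_empty by blast
  then show ?thesis using that kdim_eq_card by metis
qed

lemma fin_dim_span: "finite S \<Longrightarrow> fin_dim K (K_span K S)"
  unfolding fin_dim_def using subspace_span by blast

lemma K_dim_eq_enat_iff: "K_dim K A = enat n \<longleftrightarrow> fin_dim K A \<and> kdim K A = n"
proof
  assume l: "K_dim K A = enat n"
  then obtain B where "finite B" "K_basis K A B"
    unfolding K_dim_def by (metis enat.distinct(2))
  then show "fin_dim K A \<and> kdim K A = n"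
    using l fin_dim_span[of B] by (auto simp: kdim_def K_basis_def)
next
  assume "fin_dim K A \<and> kdim K A = n"
  then show "K_dim K A = enat n" using basis_exists K_dim_eq_card by metis
qed

lemma fin_dim_subset: "fin_dim K B \<Longrightarrow> K_subspace K A \<Longrightarrow> A \<subseteq> B \<Longrightarrow> fin_dim K A"
  unfolding fin_dim_def by blast

lemma extend_basis_fin_dim:
  assumes "fin_dim K A" "J \<subseteq> A" "K_independent K J" "finite J"
  obtains B where "finite B" "J \<subseteq> B" "K_basis K A B" "card B = kdim K A"
proof -
  obtain S where "K_subspace K A" "A \<subseteq> K_span K S" "finite S"
    using assms unfolding fin_dim_def by blast
  then obtain B where "finite B" "J \<subseteq> B" "K_basis K A B"
    using extend_basis[of A S J] assms by blast
  then show ?thesis using that kdim_eq_card by metis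
qed

lemma card_le_kdim: "fin_dim K A \<Longrightarrow> finite I \<Longrightarrow> K_independent K I \<Longrightarrow> I \<subseteq> A \<Longrightarrow> card I \<le> kdim K A"
proof -
  assume *: "fin_dim K A" "finite I" "K_independent K I" "I \<subseteq> A"
  obtain B where "finite B" "I \<subseteq> B" "K_basis K A B" "card B = kdim K A"
    by (rule extend_basis_fin_dim[OF *(1,4,3,2)])
  then show ?thesis by (metis card_mono)
qed

lemma kdim_span_le: "finite S \<Longrightarrow> kdim K (K_span K S) \<le> card S"
proof -
  assume "finite S"
  then obtain B where "finite B" "K_basis K (K_span K S) B" "card B = kdim K (K_span K S)"
    by (rule basis_exists[OF fin_dim_span])
  then show ?thesis using steinitz[of B S] \<open>finite S\<close> by (auto simp: K_basis_def)
qed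

lemma kdim_mono:
  assumes "fin_dim K B" "K_subspace K A" "A \<subseteq> B"
  shows "kdim K A \<le> kdim K B"
proof -
  obtain I where "finite I" "K_basis K A I" "card I = kdim K A"
    using basis_exists fin_dim_subset[OF assms] by blast
  then show ?thesis using card_le_kdim[OF assms(1), of I] assms(3) by (auto simp: K_basis_def)
qed

lemma subspace_eq_if_kdim_le:
  assumes "fin_dim K B" "K_subspace K A" "A \<subseteq> B" "kdim K B \<le> kdim K A"
  shows "A = B"
proof -
  obtain I where I: "finite I" "K_basis K A I" "card I = kdim K A"
    using basis_exists fin_dim_subset[OF assms(1-3)] by blast
  then obtain J where "finite J" "I \<subseteq> J" "K_basis K B J" "card J = kdim K B"
    using extend_basis_fin_dim[OF assms(1), of I] assms(3) by (auto simp: K_basis_def)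
  then show ?thesis using I assms(4) card_seteq[of J I] by (auto simp: K_basis_def)
qed

lemma fin_dim_Int: "fin_dim K A \<Longrightarrow> K_subspace K B \<Longrightarrow> fin_dim K (A \<inter> B)"
  using fin_dim_subset subspace_Int fin_dim_subspace by (metis inf_le1)

lemma fin_dim_sums:
  assumes "fin_dim K A" "fin_dim K B"
  shows "fin_dim K {a + b |a b. a \<in> A \<and> b \<in> B}"
proof -
  obtain S where "finite S" "K_basis K A S" "card S = kdim K A" by (rule basis_exists[OF assms(1)])
  moreover obtain T where "finite T" "K_basis K B T" "card T = kdim K B"
    by (rule basis_exists[OF assms(2)])
  ultimately show ?thesis using fin_dim_span[of "S \<union> T"] span_Un[of S T] by (simp add: K_basis_def)
qed

text \<open>The core of the dimension formula: \<open>I\<close> will be a basis of an intersection,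
  \<open>I \<union> J\<close> and \<open>B\<close> bases of the two spaces. If some \<open>j\<close>
  depended on the rest, its \<open>B\<close>-component would lie in the intersection, hence in the
  span of \<open>I\<close>, and \<open>I \<union> J\<close> would be dependent.\<close>

lemma independent_Un:
  assumes "finite J" "K_independent K (I \<union> J)" "I \<inter> J = {}" "K_span K (I \<union> J) \<inter> K_span K B \<subseteq> K_span K I"
    "I \<subseteq> B" "K_independent K B"
  shows "K_independent K (B \<union> J) \<and> B \<inter> J = {}"
  using assms(1-4)
proof (induction J rule: finite_induct)
  case empty
  then show ?case using assms by simp
next
  case (insert j J)
  have j: "K_independent K (I \<union> J)" "j \<notin> K_span K (I \<union> J)"
    using independent_insert[of j "I \<union> J"] insert by auto
  have IH: "K_independent K (B \<union> J)" "B \<inter> J = {}"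
    using insert j span_mono[of "I \<union> J" "I \<union> insert j J"] by auto
  have "j \<notin> K_span K (B \<union> J)"
  proof
    assume "j \<in> K_span K (B \<union> J)"
    then obtain x y where xy: "j = x + y" "x \<in> K_span K B" "y \<in> K_span K J"
      using span_Un by auto
    have "y \<in> K_span K (I \<union> insert j J)" using xy span_mono[of J "I \<union> insert j J"] by auto
    then have "j - y \<in> K_span K (I \<union> insert j J)"
      using span_base[of j] by (intro subspace_diff subspace_span) auto
    then have "x \<in> K_span K I" using xy insert.prems(3) by auto
    then have "j \<in> K_span K (I \<union> J)" using xy span_Un by blast
    with j show False by blast
  qed
  moreover from this have "j \<notin> B \<union> J" using span_base by blast
  ultimately show ?case using independent_insert[of j "B \<union> J"] IH by auto
qed

lemma kdim_sums_Int:
  assumes "fin_dim K A" "fin_dim K B"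
  shows "kdim K {a + b |a b. a \<in> A \<and> b \<in> B} + kdim K (A \<inter> B) = kdim K A + kdim K B"
proof -
  have sub: "K_subspace K A" "K_subspace K B" using assms by (auto simp: fin_dim_def)
  obtain I where I: "finite I" "K_basis K (A \<inter> B) I" "card I = kdim K (A \<inter> B)"
    using basis_exists fin_dim_Int assms(1) sub by blast
  obtain X where X: "finite X" "I \<subseteq> X" "K_basis K A X" "card X = kdim K A"
    using I extend_basis_fin_dim[OF assms(1), of I] by (auto simp: K_basis_def)
  obtain Y where Y: "finite Y" "I \<subseteq> Y" "K_basis K B Y" "card Y = kdim K B"
    using I extend_basis_fin_dim[OF assms(2), of I] by (auto simp: K_basis_def)
  define J where "J = X - I"
  have IJ: "I \<union> J = X" "I \<inter> J = {}" using X J_def by auto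
  have ind: "K_independent K (Y \<union> J) \<and> Y \<inter> J = {}"
    using X Y I IJ by (intro independent_Un[of J I]) (auto simp: K_basis_def J_def)
  have "K_span K (Y \<union> J) = K_span K (X \<union> Y)"
    using IJ Y(2) by (intro arg_cong[of _ _ "K_span K"]) auto
  also have "\<dots> = {a + b |a b. a \<in> A \<and> b \<in> B}"
    using span_Un[of X Y] X Y by (simp add: K_basis_def)
  finally have "kdim K {a + b |a b. a \<in> A \<and> b \<in> B} = card (Y \<union> J)"
    using ind X Y span_superset[of "Y \<union> J"] by (intro kdim_eq_card) (auto simp: K_basis_def J_def)
  also have "\<dots> = card Y + card J" using ind X Y by (intro card_Un_disjoint) (auto simp: J_def)
  finally show ?thesis
    using X Y I card_mono[OF X(1,2)] card_Diff_subset[OF I(1) X(2)] unfolding J_def by linarith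
qed

lemma independent_image_mult:
  assumes "y \<noteq> 0" "finite S" "K_independent K S"
  shows "K_independent K ((*) y ` S)"
  using assms(2,3)
proof (induction S rule: finite_induct)
  case empty
  then show ?case using independent_empty by simp
next
  case (insert a S)
  then have "K_independent K ((*) y ` S)" "a \<notin> K_span K S" using independent_insert by auto
  moreover from this have "y * a \<notin> K_span K ((*) y ` S)" "y * a \<notin> (*) y ` S"
    using span_image_mult assms(1) insert.hyps by auto
  ultimately show ?case using independent_insert by auto
qed

lemma
  assumes "fin_dim K A"
  shows fin_dim_image_mult: "fin_dim K ((*) y ` A)"
    and kdim_image_mult: "y \<noteq> 0 \<Longrightarrow> kdim K ((*) y ` A) = kdim K A"
proof -
  obtain B where B: "finite B" "K_basis K A B" "card B = kdim K A"
    using basis_exists assms by blast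
  show "fin_dim K ((*) y ` A)"
    using fin_dim_span[of "(*) y ` B"] B span_image_mult by (auto simp: K_basis_def)
  assume y: "y \<noteq> 0"
  have "K_basis K ((*) y ` A) ((*) y ` B)"
    using B independent_image_mult[OF y] by (auto simp: K_basis_def span_image_mult)
  then have "kdim K ((*) y ` A) = card ((*) y ` B)" using B by (intro kdim_eq_card) auto
  also have "\<dots> = card B" using y by (intro card_image) (auto simp: inj_on_def)
  finally show "kdim K ((*) y ` A) = kdim K A" using B by simp
qed

text \<open>An injective linear map of a finite-dimensional space into itself is onto. This is the
  source of inverses in stabilizers and in finite-dimensional rings.\<close>

lemma image_mult_eq:
  assumes "fin_dim K A" "x \<noteq> 0" "\<And>a. a \<in> A \<Longrightarrow> x * a \<in> A"
  shows "(*) x ` A = A"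
  using assms kdim_image_mult[OF assms(1,2)]
  by (intro subspace_eq_if_kdim_le subspace_image_mult) (auto simp: fin_dim_def)

lemma kdim_zero: "kdim K {0} = 0" and fin_dim_zero: "fin_dim K {0}"
  using kdim_eq_card[of "{}" "{0}"] fin_dim_span[of "{}"] by (auto simp: K_basis_def span_empty independent_empty)

lemma kdim_pos:
  assumes "fin_dim K A" "x \<in> A" "x \<noteq> 0"
  shows "0 < kdim K A"
proof -
  have "K_independent K {x}" using independent_insert[of x "{}"] independent_empty span_empty assms by auto
  then show ?thesis using card_le_kdim[OF assms(1), of "{x}"] assms by simp
qed

end

subsection \<open>Polynomials and simple extensions\<close>

definition stab :: "'a::field set \<Rightarrow> 'a set" where
  "stab C = {x. \<forall>c\<in>C. x * c \<in> C}"

definition polys :: "'a::field set \<Rightarrow> 'a poly set" where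
  "polys K = {p. \<forall>i. coeff p i \<in> K}"

text \<open>The ring K[x]; it is the field K(x) as soon as \<open>x\<close> is algebraic over
  \<open>K\<close>, see \<open>subfield_adj\<close>.\<close>

definition adj :: "'a::field set \<Rightarrow> 'a \<Rightarrow> 'a set" where
  "adj K x = {poly p x |p. p \<in> polys K}"

lemma span_restrict: "K \<subseteq> H \<Longrightarrow> K_span K S \<subseteq> K_span H S"
  unfolding K_span_def by blast

lemma polys_mono: "K \<subseteq> H \<Longrightarrow> polys K \<subseteq> polys H"
  by (auto simp: polys_def)

lemma polysD: "p \<in> polys K \<Longrightarrow> coeff p i \<in> K"
  by (simp add: polys_def)

lemma adj_mono: "K \<subseteq> H \<Longrightarrow> adj K x \<subseteq> adj H x"
  using polys_mono unfolding adj_def by blast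

lemma K_algebraic_iff: "K_algebraic K x \<longleftrightarrow> (\<exists>p\<in>polys K. p \<noteq> 0 \<and> poly p x = 0)"
  by (auto simp: K_algebraic_def polys_def)

lemma K_algebraic_mono: "K_algebraic K x \<Longrightarrow> K \<subseteq> H \<Longrightarrow> K_algebraic H x"
  using polys_mono unfolding K_algebraic_iff by blast

lemma K_min_poly_iff:
  "K_min_poly K x p \<longleftrightarrow> lead_coeff p = 1 \<and> p \<in> polys K \<and> poly p x = 0 \<and>
     (\<forall>q\<in>polys K. q \<noteq> 0 \<and> poly q x = 0 \<longrightarrow> degree p \<le> degree q)"
  by (auto simp: K_min_poly_def polys_def)

context subfield
begin

lemma subspace_self: "K_subspace K K"
  by (auto simp: K_subspace_def add_mem mult_mem)

lemma subspace_extension: "subfield_of H \<Longrightarrow> K \<subseteq> H \<Longrightarrow> K_subspace K H"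
  by (auto simp: K_subspace_def subfield_of_def)

lemma fin_dim_multiplier:
  assumes "fin_dim K C" "K_subspace K H" "v \<noteq> 0" "\<And>h. h \<in> H \<Longrightarrow> h * v \<in> C"
  shows "fin_dim K H"
proof (rule fin_dim_subset[OF fin_dim_image_mult[OF assms(1), of "inverse v"] assms(2)], rule)
  fix h assume "h \<in> H"
  then have "h = inverse v * (h * v)" "h * v \<in> C" using assms by auto
  then show "h \<in> (*) (inverse v) ` C" by blast
qed

lemma subspace_stab: "K_subspace K C \<Longrightarrow> K_subspace K (stab C)"
  by (auto simp: K_subspace_def stab_def distrib_right mult.assoc)

text \<open>A nonzero stabilizing element maps \<open>C\<close> onto itself, so its inverse
  stabilizes \<open>C\<close> too. The vector \<open>v\<close> embeds the stabilizer into
  \<open>C\<close> and so bounds its dimension.\<close>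

lemma
  assumes "fin_dim K C" "v \<in> C" "v \<noteq> 0"
  shows subfield_stab: "subfield_of (stab C)"
    and subset_stab: "K \<subseteq> stab C"
    and fin_dim_stab: "fin_dim K (stab C)"
proof -
  have sub: "K_subspace K C" using assms fin_dim_def by blast
  show "K \<subseteq> stab C" using subspace_scale[OF sub] by (auto simp: stab_def)
  show "fin_dim K (stab C)"
    using assms by (intro fin_dim_multiplier[OF assms(1) subspace_stab[OF sub] assms(3)])
      (auto simp: stab_def)
  have inv: "inverse x \<in> stab C" if x: "x \<in> stab C" for x
  proof (cases "x = 0")
    case False
    have *: "(*) x ` C = C" using x False by (intro image_mult_eq assms) (auto simp: stab_def)
    have "inverse x * c \<in> C" if "c \<in> C" for c
    proof -
      obtain d where "d \<in> C" "c = x * d" using * \<open>c \<in> C\<close> by blast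
      then show ?thesis using False by (simp flip: mult.assoc)
    qed
    then show ?thesis by (simp add: stab_def)
  qed (use subspace_zero[OF sub] in \<open>simp add: stab_def\<close>)
  show "subfield_of (stab C)"
    unfolding subfield_of_def
    using inv subspace_add[OF sub] subspace_zero[OF sub] subspace_diff[OF sub 
      subspace_zero[OF sub]] by (auto simp: stab_def distrib_right mult.assoc)
qed

text \<open>Each new basis vector \<open>a\<close> contributes the line \<open>a H\<close>, a copy
  of \<open>H\<close>, which meets the span of the earlier vectors only in 0.\<close>

lemma
  assumes H: "subfield_of H" "K \<subseteq> H" "fin_dim K H" and X: "finite X" "K_independent H X"
  shows fin_dim_span_extension: "fin_dim K (K_span H X)"
    and kdim_span_extension: "kdim K (K_span H X) = kdim K H * card X"
proof -
  interpret H: subfield H by standard (rule H)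
  have "fin_dim K (K_span H X) \<and> kdim K (K_span H X) = kdim K H * card X"
    using X
  proof (induction X rule: finite_induct)
    case empty
    then show ?case using kdim_zero fin_dim_zero by (simp add: H.span_empty)
  next
    case (insert a X)
    then have IH: "fin_dim K (K_span H X)" "kdim K (K_span H X) = kdim K H * card X"
      and a: "a \<notin> K_span H X"
      using H.independent_insert by auto
    then have a0: "a \<noteq> 0" using H.subspace_zero[OF H.subspace_span] by metis
    let ?aH = "(*) a ` H"
    have eq: "K_span H (insert a X) = {u + v |u v. u \<in> ?aH \<and> v \<in> K_span H X}"
      unfolding H.span_insert by (force simp: mult.commute)
    have fin: "fin_dim K ?aH" using H fin_dim_image_mult by blast
    have "?aH \<inter> K_span H X = {0}"
    proof -
      have "h = 0" if "h \<in> H" "h * a \<in> K_span H X" for h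
        using H.subspace_cancel_scale[OF H.subspace_span that(1) _ that(2)] a by blast
      then show ?thesis using H.subspace_zero[OF H.subspace_span, of X]
        by (auto simp: mult.commute intro!: image_eqI[of _ _ 0])
    qed
    then have "kdim K (K_span H (insert a X)) + 0 = kdim K ?aH + kdim K (K_span H X)"
      using kdim_sums_Int[OF fin IH(1)] kdim_zero unfolding eq by simp
    then show ?case
      unfolding eq using fin_dim_sums[OF fin IH(1)] IH insert.hyps kdim_image_mult[OF H(3) a0]
      by simp
  qed
  then show "fin_dim K (K_span H X)" "kdim K (K_span H X) = kdim K H * card X" by auto
qed

lemma
  assumes H: "subfield_of H" "K \<subseteq> H" "fin_dim K H" and A: "fin_dim H A"
  shows fin_dim_tower: "fin_dim K A"
    and kdim_tower: "kdim K A = kdim K H * kdim H A"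
proof -
  interpret H: subfield H by standard (rule H)
  obtain X where "finite X" "K_basis H A X" "card X = kdim H A" by (rule H.basis_exists[OF A])
  then show "fin_dim K A" "kdim K A = kdim K H * kdim H A"
    using fin_dim_span_extension[OF H, of X] kdim_span_extension[OF H, of X] by (auto simp: K_basis_def)
qed

section \<open>Polynomials over a subfield and the ring K[x]\<close>

lemma polys_0: "0 \<in> polys K"
  by (simp add: polys_def)

lemma polys_add: "p \<in> polys K \<Longrightarrow> q \<in> polys K \<Longrightarrow> p + q \<in> polys K"
  and polys_diff: "p \<in> polys K \<Longrightarrow> q \<in> polys K \<Longrightarrow> p - q \<in> polys K"
  and polys_mult: "p \<in> polys K \<Longrightarrow> q \<in> polys K \<Longrightarrow> p * q \<in> polys K"
  and polys_smult: "c \<in> K \<Longrightarrow> p \<in> polys K \<Longrightarrow> smult c p \<in> polys K"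
  and polys_monom: "c \<in> K \<Longrightarrow> monom c n \<in> polys K"
  by (auto simp: polys_def coeff_mult intro!: sum_mem mult_mem add_mem diff_mem)

lemma polys_pCons: "pCons a p \<in> polys K \<longleftrightarrow> a \<in> K \<and> p \<in> polys K"
  unfolding polys_def using coeff_pCons_0[of a p] coeff_pCons_Suc[of a p]
  by (auto simp: coeff_pCons split: nat.split)

lemma polys_pcompose:
  assumes "p \<in> polys K" "q \<in> polys K"
  shows "pcompose p q \<in> polys K"
  using assms(1)
proof (induction p)
  case (pCons a p)
  then show ?case using assms(2) polys_pCons[of a 0] polys_pCons[of a p]
    by (auto simp: pcompose_pCons polys_0 intro!: polys_add polys_mult)
qed (simp add: polys_0)

lemma poly_mem: "p \<in> polys K \<Longrightarrow> x \<in> K \<Longrightarrow> poly p x \<in> K"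
  by (auto simp: poly_altdef polys_def intro!: sum_mem mult_mem power_mem)

text \<open>Quotient and remainder must have coefficients in \<open>K\<close>, so they are built
  along \<open>p\<close>: in passing from \<open>p\<close> to \<open>pCons a p\<close> the shifted
  remainder is corrected by a multiple of \<open>d\<close> whose factor is a quotient of elements of
  \<open>K\<close>. Describing the remainder by vanishing coefficients from \<open>n\<close> on
  includes the remainder 0 without a case split.\<close>

lemma polys_division:
  assumes "p \<in> polys K" "d \<in> polys K" "d \<noteq> 0"
  obtains q r where "q \<in> polys K" "r \<in> polys K" "p = d * q + r" "r = 0 \<or> degree r < degree d"
proof -
  define n where "n = degree d"
  have "\<exists>q\<in>polys K. \<exists>r\<in>polys K. p = d * q + r \<and> (\<forall>i\<ge>n. coeff r i = 0)"
    using assms(1)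
  proof (induction p)
    case 0
    then show ?case using polys_0 by (intro bexI[of _ 0]) auto
  next
    case (pCons a p)
    then obtain q r where qr: "q \<in> polys K" "r \<in> polys K" "p = d * q + r" "\<forall>i\<ge>n. coeff r i = 0"
      using polys_pCons by blast
    define c where "c = coeff (pCons a r) n / lead_coeff d"
    have ar: "pCons a r \<in> polys K" using pCons qr polys_pCons by blast
    have c: "c \<in> K" unfolding c_def using ar assms by (intro divide_mem) (auto simp: polys_def)
    let ?r = "pCons a r - smult c d" and ?q = "pCons c q"
    have "pCons a p = d * ?q + ?r" by (simp add: qr(3) algebra_simps)
    moreover have "coeff ?r i = 0" if "i \<ge> n" for i
    proof (cases "i = n")
      case True
      then show ?thesis using assms(3) by (simp add: c_def n_def)
    next
      case False
      then show ?thesis using that qr(4) by (cases i) (auto simp: n_def coeff_eq_0)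
    qed
    moreover have "?q \<in> polys K" "?r \<in> polys K"
      using qr c ar assms(2) by (auto simp: polys_pCons intro!: polys_diff polys_smult)
    ultimately show ?case by blast
  qed
  then obtain q r where qr: "q \<in> polys K" "r \<in> polys K" "p = d * q + r" "\<forall>i\<ge>n. coeff r i = 0"
    by blast
  moreover have "r = 0 \<or> degree r < degree d"
    using qr(4) n_def leading_coeff_0_iff[of r] not_le by blast
  ultimately show ?thesis using that by blast
qed

lemma min_poly_exists:
  assumes "K_algebraic K x"
  obtains p where "K_min_poly K x p"
proof -
  obtain p where p: "p \<in> polys K \<and> p \<noteq> 0 \<and> poly p x = 0"
    "\<And>q. q \<in> polys K \<and> q \<noteq> 0 \<and> poly q x = 0 \<Longrightarrow> degree p \<le> degree q"
  proof -
    let ?P = "\<lambda>p. p \<in> polys K \<and> p \<noteq> 0 \<and> poly p x = 0"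
    obtain p where "?P p" using assms unfolding K_algebraic_iff by blast
    then show ?thesis using that ex_has_least_nat[of ?P p degree] by metis
  qed
  have "K_min_poly K x (smult (inverse (lead_coeff p)) p)"
    unfolding K_min_poly_iff using p by (auto intro!: polys_smult inverse_mem simp: polysD)
  then show ?thesis using that by blast
qed

lemma min_poly_dvd:
  assumes "K_min_poly K x p" "q \<in> polys K" "poly q x = 0"
  shows "p dvd q"
proof -
  have p: "p \<in> polys K" "p \<noteq> 0" "poly p x = 0" using assms by (auto simp: K_min_poly_iff)
  obtain s r where r: "r \<in> polys K" "q = p * s + r" "r = 0 \<or> degree r < degree p"
    using polys_division[OF assms(2) p(1,2)] by blast
  then have "poly r x = 0" using assms p by simp
  then have "r = 0" using r assms(1) unfolding K_min_poly_iff by (meson not_le)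
  then show ?thesis using r by simp
qed

lemma min_poly_degree_pos: "K_min_poly K x p \<Longrightarrow> 0 < degree p"
  unfolding K_min_poly_iff by (metis degree_0_id gr0I lead_coeff_pCons(2) one_pCons poly_1 zero_neq_one
    pCons_0_0 degree_eq_zeroE)

lemma subset_adj: "K \<subseteq> adj K x"
proof
  fix k assume "k \<in> K"
  then have "[:k:] \<in> polys K" "poly [:k:] x = k" by (auto simp: polys_pCons polys_0)
  then show "k \<in> adj K x" unfolding adj_def by (metis (mono_tags, lifting) CollectI)
qed

lemma mem_adj: "x \<in> adj K x"
proof -
  have "[:0, 1:] \<in> polys K" "poly [:0, 1:] x = x" by (auto simp: polys_pCons polys_0)
  then show ?thesis unfolding adj_def by (metis (mono_tags, lifting) CollectI)
qed

lemma adj_add: "a \<in> adj K x \<Longrightarrow> b \<in> adj K x \<Longrightarrow> a + b \<in> adj K x"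
  and adj_mult: "a \<in> adj K x \<Longrightarrow> b \<in> adj K x \<Longrightarrow> a * b \<in> adj K x"
  unfolding adj_def using polys_add polys_mult by (force simp flip: poly_add poly_mult)+

lemma subspace_adj: "K_subspace K (adj K x)"
  unfolding K_subspace_def using subset_adj[of x] zero_mem adj_add adj_mult by blast

lemma adj_subset:
  assumes "subfield_of H" "K \<subseteq> H" "x \<in> H"
  shows "adj K x \<subseteq> H"
  using subfield.poly_mem[of H _ x] assms polys_mono[of K H]
  unfolding adj_def by (auto simp: subfield_def)

lemma adj_eq_span:
  assumes "p \<in> polys K" "p \<noteq> 0" "poly p x = 0"
  shows "adj K x = K_span K ((\<lambda>i. x ^ i) ` {..<degree p})"
proof
  show "adj K x \<subseteq> K_span K ((\<lambda>i. x ^ i) ` {..<degree p})"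
  proof
    fix y assume "y \<in> adj K x"
    then obtain q where q: "q \<in> polys K" "y = poly q x" unfolding adj_def by blast
    obtain s r where r: "r \<in> polys K" "q = p * s + r" "r = 0 \<or> degree r < degree p"
      using polys_division[OF q(1) assms(1,2)] by blast
    have "y = poly r x" using q r assms(3) by simp
    also have "\<dots> = (\<Sum>i\<le>degree r. coeff r i * x ^ i)" by (rule poly_altdef)
    also have "\<dots> \<in> K_span K ((\<lambda>i. x ^ i) ` {..<degree p})"
    proof (cases "r = 0")
      case True
      then show ?thesis using subspace_zero[OF subspace_span] by simp
    next
      case False
      then show ?thesis
        using r polysD[OF r(1)] by (intro subspace_sum subspace_scale subspace_span span_base) auto
    qed
    finally show "y \<in> K_span K ((\<lambda>i. x ^ i) ` {..<degree p})" .
  qed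
  have "x ^ i \<in> adj K x" for i
    using mem_adj[of x] subset_adj[of x] one_mem adj_mult by (induction i) auto
  then show "K_span K ((\<lambda>i. x ^ i) ` {..<degree p}) \<subseteq> adj K x"
    by (intro span_minimal subspace_adj) auto
qed

lemma fin_dim_adj: "K_algebraic K x \<Longrightarrow> fin_dim K (adj K x)"
  unfolding K_algebraic_iff using adj_eq_span fin_dim_span by (metis finite_imageI finite_lessThan)

lemma kdim_adj_le:
  assumes "p \<in> polys K" "p \<noteq> 0" "poly p x = 0"
  shows "kdim K (adj K x) \<le> degree p"
proof -
  have "card ((\<lambda>i. x ^ i) ` {..<degree p}) \<le> degree p" using card_image_le[of "{..<degree p}"] by simp
  then show ?thesis unfolding adj_eq_span[OF assms]
    using kdim_span_le[of "(\<lambda>i. x ^ i) ` {..<degree p}"] by simp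
qed

lemma subfield_finite_dim_ring:
  assumes "fin_dim K R" "K \<subseteq> R" "\<And>x y. x \<in> R \<Longrightarrow> y \<in> R \<Longrightarrow> x * y \<in> R"
  shows "subfield_of R"
proof -
  have sub: "K_subspace K R" using assms fin_dim_def by blast
  have "1 \<in> R" using assms(2) one_mem by blast
  have inv: "inverse x \<in> R" if "x \<in> R" for x
  proof (cases "x = 0")
    case False
    then have "(*) x ` R = R" using that assms by (intro image_mult_eq) auto
    then obtain y where "y \<in> R" "1 = x * y" using \<open>1 \<in> R\<close> by blast
    then show ?thesis by (metis inverse_unique)
  qed (use that in simp)
  have "- x \<in> R" if "x \<in> R" for x
    using subspace_diff[OF sub subspace_zero[OF sub] that] by simp
  then show ?thesis
    unfolding subfield_of_def using inv \<open>1 \<in> R\<close> subspace_zero[OF sub] subspace_add[OF sub] assms(3)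
    by (intro conjI ballI) auto
qed

lemma subfield_adj: "K_algebraic K x \<Longrightarrow> subfield_of (adj K x)"
  using subfield_finite_dim_ring[OF fin_dim_adj subset_adj] adj_mult by blast

lemma span_powers:
  "K_span K ((\<lambda>i. x ^ i * w) ` {..<n}) \<subseteq> {poly p x * w |p. p \<in> polys K \<and> (\<forall>i\<ge>n. coeff p i = 0)}"
  (is "_ \<subseteq> ?R")
proof (rule span_minimal)
  show "K_subspace K ?R"
    unfolding K_subspace_def
  proof (intro conjI ballI)
    show "0 \<in> ?R" using polys_0 by (intro CollectI exI[of _ 0]) auto
  next
    fix a b assume "a \<in> ?R" "b \<in> ?R"
    then obtain p q where "a = poly p x * w" "p \<in> polys K" "\<forall>i\<ge>n. coeff p i = 0"
      "b = poly q x * w" "q \<in> polys K" "\<forall>i\<ge>n. coeff q i = 0" by blast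
    then show "a + b \<in> ?R" using polys_add[of p q]
      by (intro CollectI exI[of _ "p + q"]) (auto simp: distrib_right)
  next
    fix c a assume "c \<in> K" "a \<in> ?R"
    then obtain p where "a = poly p x * w" "p \<in> polys K" "\<forall>i\<ge>n. coeff p i = 0" by blast
    then show "c * a \<in> ?R" using polys_smult[OF \<open>c \<in> K\<close>, of p]
      by (intro CollectI exI[of _ "smult c p"]) auto
  qed
  show "(\<lambda>i. x ^ i * w) ` {..<n} \<subseteq> ?R"
  proof clarify
    fix i assume "i < n"
    then show "\<exists>p. x ^ i * w = poly p x * w \<and> p \<in> polys K \<and> (\<forall>i\<ge>n. coeff p i = 0)"
      using polys_monom[of 1 i] by (intro exI[of _ "monom 1 i"]) (auto simp: poly_monom)
  qed
qed

text \<open>A linear relation would be a polynomial of degree below \<open>n\<close> that kills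
  \<open>x\<close>. The factor \<open>w\<close> is 1 for the powers of \<theta> in the upper bound,
  and a vector of an \<open>x\<close>-stable space in
  \<open>algebraic_if_stabilizes\<close>.\<close>

lemma independent_powers:
  assumes "\<And>p. p \<in> polys K \<Longrightarrow> p \<noteq> 0 \<Longrightarrow> degree p < n \<Longrightarrow> poly p x \<noteq> 0" "w \<noteq> 0"
  shows "K_independent K ((\<lambda>i. x ^ i * w) ` {..<n}) \<and> card ((\<lambda>i. x ^ i * w) ` {..<n}) = n"
  using assms(1)
proof (induction n)
  case 0
  then show ?case using independent_empty by simp
next
  case (Suc n)
  then have IH: "K_independent K ((\<lambda>i. x ^ i * w) ` {..<n})" "card ((\<lambda>i. x ^ i * w) ` {..<n}) = n"
    by auto
  have "x ^ n * w \<notin> K_span K ((\<lambda>i. x ^ i * w) ` {..<n})"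
  proof
    assume "x ^ n * w \<in> K_span K ((\<lambda>i. x ^ i * w) ` {..<n})"
    then obtain p where p: "x ^ n * w = poly p x * w" "p \<in> polys K" "\<forall>i\<ge>n. coeff p i = 0"
      using span_powers by blast
    let ?q = "monom 1 n - p"
    have "coeff ?q n = 1" "\<And>i. i > n \<Longrightarrow> coeff ?q i = 0" using p by auto
    then have "?q \<noteq> 0" "degree ?q < Suc n"
      by (metis coeff_0 zero_neq_one, metis degree_le less_Suc_eq_le)
    moreover have "?q \<in> polys K" using p by (intro polys_diff polys_monom) auto
    moreover have "poly ?q x = 0" using p assms(2) by (simp add: poly_monom)
    ultimately show False using Suc.prems by blast
  qed
  moreover from this have "x ^ n * w \<notin> (\<lambda>i. x ^ i * w) ` {..<n}"
    by (rule contra_subsetD[OF span_superset])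
  moreover have "finite ((\<lambda>i. x ^ i * w) ` {..<n})" by simp
  ultimately show ?case
    unfolding lessThan_Suc image_insert using IH by (metis independent_insert card_insert_disjoint)
qed

text \<open>Otherwise the vectors \<open>x ^ i * w\<close>, all in \<open>W\<close>, would be
  independent, one more of them than the dimension allows.\<close>

lemma algebraic_if_stabilizes:
  assumes "fin_dim K W" "w \<in> W" "w \<noteq> 0" "\<And>v. v \<in> W \<Longrightarrow> x * v \<in> W"
  shows "K_algebraic K x"
proof (rule ccontr)
  assume "\<not> K_algebraic K x"
  then have "K_independent K ((\<lambda>i. x ^ i * w) ` {..<Suc (kdim K W)})"
    "card ((\<lambda>i. x ^ i * w) ` {..<Suc (kdim K W)}) = Suc (kdim K W)"
    using independent_powers[of "Suc (kdim K W)" x w] assms(3) unfolding K_algebraic_iff by blast+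
  moreover have "x ^ i * w \<in> W" for i
    using assms by (induction i) (auto simp: mult.assoc)
  ultimately show False
    using card_le_kdim[OF assms(1), of "(\<lambda>i. x ^ i * w) ` {..<Suc (kdim K W)}"] by auto
qed

lemma algebraic_if_mem: "fin_dim K H \<Longrightarrow> subfield_of H \<Longrightarrow> x \<in> H \<Longrightarrow> K_algebraic K x"
  using algebraic_if_stabilizes[of H 1 x] by (auto simp: subfield_of_def)

lemma algebraic_trans:
  assumes H: "subfield_of H" "K \<subseteq> H" "fin_dim K H" and "K_algebraic H x"
  shows "K_algebraic K x"
proof -
  interpret H: subfield H by standard (rule H)
  have "fin_dim K (adj H x)" using fin_dim_tower[OF H H.fin_dim_adj[OF assms(4)]] .
  moreover have "1 \<in> adj H x" using H.subset_adj H.one_mem by blast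
  ultimately show ?thesis
    by (rule algebraic_if_stabilizes) (auto intro: H.adj_mult H.mem_adj)
qed

text \<open>If \<open>H1\<close> and \<open>H2\<close> give the same minimal polynomial \<open>d\<close> of \<open>\<theta>\<close>, then reducing
  polynomials over \<open>K\<close> modulo \<open>d\<close> gives coefficients in \<open>H1 \<inter> H2\<close>, which forces \<open>H1 = H2\<close>.\<close>

lemma min_poly_determines_subfield:
  assumes H1: "subfield_of H1" "K \<subseteq> H1" "H1 \<subseteq> adj K \<theta>" "K_min_poly H1 \<theta> d"
    and H2: "subfield_of H2" "K \<subseteq> H2" "K_min_poly H2 \<theta> d"
  shows "H1 \<subseteq> H2"
proof
  fix x assume x: "x \<in> H1"
  interpret I: subfield "H1 \<inter> H2"
    using H1 H2 by unfold_locales (auto simp: subfield_of_def)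
  interpret H1: subfield H1 by standard (rule H1)
  obtain p where p: "p \<in> polys K" "x = poly p \<theta>" using x H1 unfolding adj_def by blast
  have d: "d \<in> polys (H1 \<inter> H2)" "d \<noteq> 0" "poly d \<theta> = 0"
    using H1 H2 by (auto simp: K_min_poly_iff polys_def)
  have "p \<in> polys (H1 \<inter> H2)" using p polys_mono[of K "H1 \<inter> H2"] H1 H2 by blast
  then obtain q r where r: "r \<in> polys (H1 \<inter> H2)" "p = d * q + r" "r = 0 \<or> degree r < degree d"
    using I.polys_division[OF _ d(1,2)] by blast
  \<comment> \<open>\<open>r\<close> and the constant \<open>x\<close> are polynomials over
    \<open>H1\<close> of degree below that of \<open>d\<close> (which is positive) with the same
    value at \<theta>. Minimality of \<open>d\<close> over \<open>H1\<close> makes them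
    equal.\<close>
  have r1: "r - [:x:] \<in> polys H1"
    using r x polys_mono[of "H1 \<inter> H2" H1] by (intro H1.polys_diff) (auto simp: H1.polys_pCons H1.polys_0)
  have "poly (r - [:x:]) \<theta> = 0" using p r d by simp
  moreover have "degree (r - [:x:]) < degree d"
    using r(3) H1.min_poly_degree_pos[OF H1(4)] by (intro degree_diff_less) auto
  ultimately have "r - [:x:] = 0"
    using r1 H1(4) unfolding K_min_poly_iff by (meson not_le)
  then have "x = coeff r 0" by simp
  then show "x \<in> H2" using polysD[OF r(1), of 0] by auto
qed

end

text \<open>A form of Euclid's lemma in which \<open>q\<close> plays the irreducible element. The
  ideal generated by \<open>q\<close> and \<open>d\<close> has a generator \<open>m\<close> dividing
  both. If \<open>m\<close> were not constant, minimality would make it a scalar multiple of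
  \<open>q\<close>, and \<open>q\<close> would divide \<open>d\<close>. So \<open>m\<close> is a
  nonzero constant of the form \<open>a * q + b * d\<close>; multiply by \<open>r\<close>.\<close>

lemma dvd_cofactor_of_minimal_divisor:
  fixes p q d r :: "'a::field poly"
  assumes "p = q * r" "d dvd p" "\<not> q dvd d" and min: "\<And>m. m dvd q \<Longrightarrow> 0 < degree m \<Longrightarrow> degree q \<le> degree m"
    and "q \<noteq> 0"
  shows "d dvd r"
proof -
  define I where "I = {a * q + b * d |a b. True}"
  have I0: "q \<in> I" "d \<in> I"
  proof -
    have "q = 1 * q + 0 * d" "d = 0 * q + 1 * d" by auto
    then show "q \<in> I" "d \<in> I" unfolding I_def by blast+
  qed
  have I_diff: "x - y * c \<in> I" if "x \<in> I" "y \<in> I" for x y c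
  proof -
    obtain a b a' b' where "x = a * q + b * d" "y = a' * q + b' * d" using \<open>x \<in> I\<close> \<open>y \<in> I\<close> I_def by blast
    then have "x - y * c = (a - a' * c) * q + (b - b' * c) * d" by (simp add: algebra_simps)
    then show ?thesis unfolding I_def by blast
  qed
  obtain m where m: "m \<in> I \<and> m \<noteq> 0" "\<And>x. x \<in> I \<and> x \<noteq> 0 \<Longrightarrow> degree m \<le> degree x"
    using ex_has_least_nat[of "\<lambda>x. x \<in> I \<and> x \<noteq> 0" q degree] I0 assms(5) by metis
  have m_dvd: "m dvd x" if "x \<in> I" for x
  proof -
    have "x mod m \<in> I" using I_diff[OF that, of m "x div m"] m by (simp add: minus_mult_div_eq_mod)
    then have "x mod m = 0" using m degree_mod_less[of m x] by (meson not_le)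
    then show ?thesis by auto
  qed
  have "degree m = 0"
  proof (rule ccontr)
    assume "degree m \<noteq> 0"
    then have "degree q \<le> degree m" using min[OF m_dvd[OF I0(1)]] by simp
    moreover obtain c where c: "q = m * c" using m_dvd[OF I0(1)] by blast
    moreover have "degree q = degree m + degree c" using c assms(5) by (auto simp: degree_mult_eq)
    ultimately have "degree c = 0" by simp
    then obtain k where "c = [:k:]" by (rule degree_eq_zeroE)
    then have "q = smult k m" "k \<noteq> 0" using c assms(5) by auto
    then have "q dvd m" by (metis smult_dvd_iff dvd_refl)
    then show False using m_dvd[OF I0(2)] assms(3) dvd_trans by blast
  qed
  then obtain k where k: "m = [:k:]" by (rule degree_eq_zeroE)
  obtain a b where ab: "m = a * q + b * d" using m I_def by blast
  have "m * r = a * p + d * (b * r)" unfolding ab assms(1) by (simp add: algebra_simps)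
  then have "d dvd m * r" using assms(2) by (simp add: dvd_add)
  then have "d dvd smult k r" using k by simp
  then show ?thesis using m k by (simp add: dvd_smult_iff)
qed

text \<open>Split off a nonconstant divisor \<open>q\<close> of least degree,
  \<open>p = q * r\<close>. A divisor of \<open>p\<close> either divides \<open>r\<close> or is
  \<open>q\<close> times a divisor of \<open>r\<close>, so the number of monic divisors at most
  doubles that of \<open>r\<close>.\<close>

lemma finite_monic_divisors:
  fixes p :: "'a::field poly"
  assumes "p \<noteq> 0"
  shows "finite {d. lead_coeff d = 1 \<and> d dvd p}"
  using assms
proof (induction "degree p" arbitrary: p rule: less_induct)
  case less
  show ?case
  proof (cases "degree p = 0")
    case True
    have "{d. lead_coeff d = 1 \<and> d dvd p} \<subseteq> {1}"
    proof clarify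
      fix d assume d: "lead_coeff d = 1" "d dvd p"
      then have "degree d = 0" using True less.prems dvd_imp_degree_le[OF d(2)] by simp
      then show "d = 1" using d(1) by (metis degree_eq_zeroE lead_coeff_pCons(2) one_pCons)
    qed
    then show ?thesis using finite_subset by blast
  next
    case False
    define P where "P = (\<lambda>m. m dvd p \<and> 0 < degree m)"
    have "P p" using False P_def by simp
    then obtain q where q: "P q" "\<And>m. P m \<Longrightarrow> degree q \<le> degree m"
      using ex_has_least_nat[of P p degree] by metis
    then obtain r where r: "p = q * r" unfolding P_def by blast
    have q0: "q \<noteq> 0" "r \<noteq> 0" using r less.prems by auto
    have deg: "degree r < degree p" using r q q0 by (simp add: degree_mult_eq P_def)
    let ?D = "{d. lead_coeff d = 1 \<and> d dvd r}"
    have fin: "finite ?D" using less.hyps[OF deg q0(2)] .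
    have "{d. lead_coeff d = 1 \<and> d dvd p} \<subseteq> ?D \<union> (\<lambda>e. smult (inverse (lead_coeff q)) (q * e)) ` ?D"
    proof
      fix d assume "d \<in> {d. lead_coeff d = 1 \<and> d dvd p}"
      then have d: "lead_coeff d = 1" "d dvd p" by auto
      show "d \<in> ?D \<union> (\<lambda>e. smult (inverse (lead_coeff q)) (q * e)) ` ?D"
      proof (cases "q dvd d")
        case True
        then obtain e where e: "d = q * e" by blast
        have "e dvd r" using d(2) q0 unfolding e r by simp
        \<comment> \<open>The rescaling makes the cofactor monic, so that it belongs to
          \<open>?D\<close>.\<close>
        define f where "f = smult (lead_coeff q) e"
        have "lead_coeff f = 1" using d(1) q0(1) unfolding e f_def by (simp add: lead_coeff_mult)
        moreover have "f dvd r" using \<open>e dvd r\<close> q0 unfolding f_def by (metis smult_dvd leading_coeff_0_iff)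
        moreover have "d = smult (inverse (lead_coeff q)) (q * f)"
          using q0 unfolding e f_def by simp
        ultimately show ?thesis by blast
      next
        case False
        have "d dvd r"
          using q(2) dvd_trans[OF _ dvdI[OF r]] by (intro dvd_cofactor_of_minimal_divisor[OF r d(2) False _ q0(1)]) (auto simp: P_def)
        then show ?thesis using d by blast
      qed
    qed
    then show ?thesis using fin finite_subset by blast
  qed
qed

text \<open>A field \<open>H\<close> is determined by the minimal polynomial of \<theta> over
  \<open>H\<close>, and all these polynomials are monic divisors of \<open>g\<close>.\<close>

lemma (in subfield) finite_subfields_adj:
  assumes "g \<in> polys K" "g \<noteq> 0" "poly g \<theta> = 0"
  shows "finite {H. subfield_of H \<and> K \<subseteq> H \<and> H \<subseteq> adj K \<theta>}" (is "finite ?F")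
proof -
  define f where "f = (\<lambda>H. SOME d. K_min_poly H \<theta> d)"
  have f: "K_min_poly H \<theta> (f H)" if "H \<in> ?F" for H
  proof -
    interpret H: subfield H using that by unfold_locales auto
    have "K_algebraic H \<theta>" using assms that K_algebraic_mono[of K \<theta> H] by (auto simp: K_algebraic_iff)
    then have "\<exists>d. K_min_poly H \<theta> d" using H.min_poly_exists by blast
    then show ?thesis unfolding f_def by (rule someI_ex)
  qed
  have "f ` ?F \<subseteq> {d. lead_coeff d = 1 \<and> d dvd g}"
  proof (rule image_subsetI)
    fix H assume H: "H \<in> ?F"
    interpret H: subfield H using H by unfold_locales auto
    have "g \<in> polys H" using assms polys_mono H by blast
    then show "f H \<in> {d. lead_coeff d = 1 \<and> d dvd g}"
      using f[OF H] H.min_poly_dvd[of \<theta> "f H" g] assms by (auto simp: K_min_poly_iff)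
  qed
  moreover have inj: "inj_on f ?F"
  proof (rule inj_onI)
    fix H1 H2 assume H: "H1 \<in> ?F" "H2 \<in> ?F" "f H1 = f H2"
    have f12: "K_min_poly H1 \<theta> (f H1)" "K_min_poly H2 \<theta> (f H1)" using f H by metis+
    have "H1 \<subseteq> H2" by (rule min_poly_determines_subfield[OF _ _ _ f12(1) _ _ f12(2)]) (use H in auto)
    moreover have "H2 \<subseteq> H1"
      by (rule min_poly_determines_subfield[OF _ _ _ f12(2) _ _ f12(1)]) (use H in auto)
    ultimately show "H1 = H2" by blast
  qed
  ultimately show ?thesis
    using inj_on_finite[OF inj _ finite_monic_divisors[OF assms(2)]] by blast
qed

subsection \<open>Primitive elements\<close>

text \<open>The remainder modulo \<open>e\<close> is linear in the dividend. Each of its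
  coefficients is thus a polynomial in \<open>c\<close>, the \<open>P\<close> of the proof, which
  vanishes for infinitely many \<open>c\<close> and hence identically.\<close>

lemma dvd_coeffs_if_dvd_infinitely_often:
  fixes e :: "'a::field poly" and w :: "nat \<Rightarrow> 'a poly"
  assumes "infinite Z" "\<And>c. c \<in> Z \<Longrightarrow> e dvd (\<Sum>k\<le>n. smult (c ^ k) (w k))" "k \<le> n"
  shows "e dvd w k"
proof -
  have "coeff (w k mod e) i = 0" for i
  proof -
    define P where "P = (\<Sum>k\<le>n. monom (coeff (w k mod e) i) k)"
    have mod_sum: "(\<Sum>k\<in>I. f k) mod e = (\<Sum>k\<in>I. f k mod e)" for f :: "nat \<Rightarrow> 'a poly" and I
      by (induction I rule: infinite_finite_induct) (auto simp: poly_mod_add_left)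
    have "poly P c = 0" if "c \<in> Z" for c
    proof -
      have "poly P c = coeff ((\<Sum>k\<le>n. smult (c ^ k) (w k)) mod e) i"
        by (simp add: P_def poly_sum poly_monom mod_sum mod_smult_left coeff_sum mult.commute)
      then show ?thesis using assms(2)[OF that] by simp
    qed
    then have "Z \<subseteq> {c. poly P c = 0}" by blast
    then have "P = 0" using assms(1) poly_roots_finite[of P] finite_subset by blast
    then have "coeff P k = 0" by simp
    moreover have "coeff P k = coeff (w k mod e) i" using assms(3) by (simp add: P_def coeff_sum)
    ultimately show ?thesis by simp
  qed
  then have "w k mod e = 0" by (intro poly_eqI) simp
  then show ?thesis by auto
qed

text \<open>One linear factor is cancelled at a time: since \<beta> is not a root of
  \<open>e\<close>, it is a root of the cofactor.\<close>

lemma dvd_linear_power_imp_const: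
  fixes e :: "'a::field poly"
  assumes "e dvd [:\<beta>, -1:] ^ n" "poly e \<beta> \<noteq> 0"
  shows "degree e = 0"
  using assms(1)
proof (induction n)
  case 0
  then show ?case using dvd_imp_degree_le[of e 1] by simp
next
  case (Suc n)
  then obtain q where q: "[:\<beta>, -1:] ^ Suc n = e * q" by blast
  have "poly (e * q) \<beta> = 0" unfolding q[symmetric] by simp
  then have "poly q \<beta> = 0" using assms(2) by simp
  then have "[:-\<beta>, 1:] dvd q" by (simp add: poly_eq_0_iff_dvd)
  then obtain s where s: "q = [:-\<beta>, 1:] * s" by blast
  have "[:\<beta>, -1:] * [:\<beta>, -1:] ^ n = [:\<beta>, -1:] * (e * (- s))"
    using q s by (simp add: algebra_simps)
  moreover have "[:\<beta>, -1:] \<noteq> 0" by simp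
  ultimately have "[:\<beta>, -1:] ^ n = e * (- s)" using mult_left_cancel by blast
  then show ?case using Suc.IH by (metis dvd_triv_left)
qed

lemma pcompose_smult_right:
  fixes F q :: "'a::field poly"
  shows "pcompose F (smult c q) = (\<Sum>k\<le>degree F. smult (c ^ k) (smult (coeff F k) (q ^ k)))"
  by (simp add: pcompose_altdef poly_altdef coeff_map_poly degree_map_poly smult_power mult.commute)

lemma (in subfield) algebraic_pair_extension:
  assumes \<alpha>: "K_algebraic K \<alpha>" and \<beta>: "K_algebraic K \<beta>"
  obtains M where "subfield_of M" "fin_dim K M" "\<alpha> \<in> M" "\<beta> \<in> M" "K \<subseteq> M"
proof -
  interpret A: subfield "adj K \<alpha>" by standard (rule subfield_adj[OF \<alpha>])
  have A\<beta>: "K_algebraic (adj K \<alpha>) \<beta>" using K_algebraic_mono[OF \<beta> subset_adj] .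
  define M where "M = adj (adj K \<alpha>) \<beta>"
  have M: "subfield_of M" "fin_dim K M" "\<alpha> \<in> M" "\<beta> \<in> M" "K \<subseteq> M"
    unfolding M_def using A.subfield_adj[OF A\<beta>] A.subset_adj[of \<beta>] mem_adj[of \<alpha>] A.mem_adj subset_adj[of \<alpha>]
      fin_dim_tower[OF A.subfield subset_adj fin_dim_adj[OF \<alpha>] A.fin_dim_adj[OF A\<beta>]] by blast+
  then show ?thesis by (rule that)
qed

text \<open>A proof that stays inside L, without conjugates. With \<theta>_c = \<alpha> + c \<beta>,
  the minimal polynomials \<open>d c\<close> of \<beta> over K(\<theta>_c) all divide
  \<open>g\<close>, so infinitely many c share one of them, (X - \<beta>) e, where e(\<beta>) is
  nonzero because \<beta> is a simple root of \<open>g\<close>. For the minimal polynomial f of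
  \<alpha> over K, the polynomial f(\<theta>_c - c X) has coefficients in K(\<theta>_c) and vanishes
  at \<beta>, so e divides it. It equals F(c (\<beta> - X)) with F(Y) = f(\<alpha> + Y). As this
  holds for infinitely many c, e divides the coefficient of each power of c, in particular the top
  one, a power of \<beta> - X. So e is constant, and the shared minimal polynomial is X -
  \<beta>.\<close>

lemma (in subfield) primitive_element_infinite:
  assumes "infinite K" and \<alpha>: "K_algebraic K \<alpha>" and \<beta>: "K_algebraic K \<beta>"
    and g: "g \<in> polys K" "g \<noteq> 0" "poly g \<beta> = 0" "\<not> [:-\<beta>, 1:]\<^sup>2 dvd g"
  shows "\<exists>\<gamma>. K_algebraic K \<gamma> \<and> \<alpha> \<in> adj K \<gamma> \<and> \<beta> \<in> adj K \<gamma>"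
proof -
  obtain M where M: "subfield_of M" "fin_dim K M" "\<alpha> \<in> M" "\<beta> \<in> M" "K \<subseteq> M"
    by (rule algebraic_pair_extension[OF \<alpha> \<beta>])
  interpret M: subfield M by standard (rule M)
  define th where "th c = \<alpha> + c * \<beta>" for c
  have th: "K_algebraic K (th c)" if "c \<in> K" for c
    using that M algebraic_if_mem[OF M(2,1)] unfolding th_def by (blast intro: M.add_mem M.mult_mem)
  define d where "d c = (SOME p. K_min_poly (adj K (th c)) \<beta> p)" for c
  have d: "K_min_poly (adj K (th c)) \<beta> (d c)" if "c \<in> K" for c
  proof -
    interpret E: subfield "adj K (th c)" by standard (rule subfield_adj[OF th[OF that]])
    have "\<exists>p. K_min_poly (adj K (th c)) \<beta> p"
      using E.min_poly_exists[OF K_algebraic_mono[OF \<beta> subset_adj]] by blast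
    then show ?thesis unfolding d_def by (rule someI_ex)
  qed
  have d_dvd: "d c dvd p" if "c \<in> K" "p \<in> polys (adj K (th c))" "poly p \<beta> = 0" for c p
  proof -
    interpret E: subfield "adj K (th c)" by standard (rule subfield_adj[OF th[OF that(1)]])
    show ?thesis using E.min_poly_dvd[OF d[OF that(1)] that(2,3)] .
  qed
  have "d ` K \<subseteq> {d. lead_coeff d = 1 \<and> d dvd g}"
  proof (rule image_subsetI)
    fix c assume c: "c \<in> K"
    have "g \<in> polys (adj K (th c))" using g(1) polys_mono[OF subset_adj] by blast
    then show "d c \<in> {d. lead_coeff d = 1 \<and> d dvd g}"
      using d_dvd[OF c] d[OF c] g(3) by (simp add: K_min_poly_iff)
  qed
  then have "finite (d ` K)" using finite_monic_divisors[OF g(2)] finite_subset by blast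
  then obtain c0 where c0: "c0 \<in> K" and inf: "infinite {c \<in> K. d c = d c0}"
    using pigeonhole_infinite[OF assms(1)] by blast
  define Z where "Z = {c \<in> K. d c = d c0}"
  have "poly (d c0) \<beta> = 0" "lead_coeff (d c0) = 1" using d[OF c0] by (auto simp: K_min_poly_iff)
  then obtain e where e: "d c0 = [:-\<beta>, 1:] * e" using poly_eq_0_iff_dvd by blast
  have "poly e \<beta> \<noteq> 0"
  proof
    assume "poly e \<beta> = 0"
    then have "[:-\<beta>, 1:] dvd e" by (simp add: poly_eq_0_iff_dvd)
    then have "[:-\<beta>, 1:] * [:-\<beta>, 1:] dvd d c0" unfolding e by (rule mult_dvd_mono[OF dvd_refl])
    moreover have "d c0 dvd g" using d_dvd[OF c0] g polys_mono[OF subset_adj] by blast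
    ultimately show False using g(4) dvd_trans by (metis power2_eq_square)
  qed
  obtain f where f: "K_min_poly K \<alpha> f" using min_poly_exists[OF \<alpha>] .
  define F where "F = pcompose f [:\<alpha>, 1:]"
  have F1: "lead_coeff F = 1"
    using f lead_coeff_comp[of "[:\<alpha>, 1:]" f] by (simp add: F_def K_min_poly_iff)
  define w where "w k = smult (coeff F k) ([:\<beta>, -1:] ^ k)" for k
  have "e dvd w (degree F)"
  proof (rule dvd_coeffs_if_dvd_infinitely_often[of Z])
    show "infinite Z" using inf by (simp add: Z_def)
    show "degree F \<le> degree F" ..
    fix c assume "c \<in> Z"
    then have c: "c \<in> K" "d c = d c0" by (auto simp: Z_def)
    interpret E: subfield "adj K (th c)" by standard (rule subfield_adj[OF th[OF c(1)]])
    have "c \<in> adj K (th c)" using subset_adj c by blast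
    then have "[:th c, - c:] \<in> polys (adj K (th c))"
      using mem_adj[of "th c"] by (auto simp: E.polys_pCons E.polys_0 intro: E.uminus_mem)
    moreover have "f \<in> polys (adj K (th c))" using f polys_mono[OF subset_adj] by (auto simp: K_min_poly_iff)
    ultimately have "pcompose f [:th c, - c:] \<in> polys (adj K (th c))" by (rule E.polys_pcompose[rotated])
    moreover have "poly (pcompose f [:th c, - c:]) \<beta> = 0"
      using f by (simp add: poly_pcompose th_def K_min_poly_iff algebra_simps)
    ultimately have "d c0 dvd pcompose f [:th c, - c:]" using d_dvd[OF c(1)] c(2) by simp
    then have "e dvd pcompose f [:th c, - c:]" unfolding e by (rule dvd_mult_right)
    also have "pcompose f [:th c, - c:] = pcompose F (smult c [:\<beta>, -1:])"
    proof -
      have "[:th c, - c:] = pcompose [:\<alpha>, 1:] (smult c [:\<beta>, -1:])"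
        by (simp add: pcompose_pCons th_def)
      then show ?thesis unfolding F_def by (simp add: pcompose_assoc)
    qed
    also have "\<dots> = (\<Sum>k\<le>degree F. smult (c ^ k) (w k))"
      unfolding w_def by (rule pcompose_smult_right)
    finally show "e dvd (\<Sum>k\<le>degree F. smult (c ^ k) (w k))" .
  qed
  then have "e dvd [:\<beta>, -1:] ^ degree F" using F1 by (simp add: w_def)
  then have "degree e = 0" using dvd_linear_power_imp_const \<open>poly e \<beta> \<noteq> 0\<close> by blast
  then obtain k where "e = [:k:]" by (rule degree_eq_zeroE)
  then have "k = 1" using \<open>lead_coeff (d c0) = 1\<close> unfolding e lead_coeff_mult by simp
  then have d0: "d c0 = [:- \<beta>, 1:]" using e \<open>e = [:k:]\<close> by simp
  interpret E: subfield "adj K (th c0)" by standard (rule subfield_adj[OF th[OF c0]])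
  have "d c0 \<in> polys (adj K (th c0))" using d[OF c0] by (simp add: K_min_poly_iff)
  then have "- \<beta> \<in> adj K (th c0)" unfolding d0 E.polys_pCons by blast
  then have b: "\<beta> \<in> adj K (th c0)" using E.uminus_mem by fastforce
  have "c0 \<in> adj K (th c0)" using c0 subset_adj by blast
  then have "th c0 - c0 * \<beta> \<in> adj K (th c0)" using b mem_adj E.diff_mem E.mult_mem by blast
  then have "\<alpha> \<in> adj K (th c0)" by (simp add: th_def)
  then show ?thesis using b th[OF c0] by blast
qed

section \<open>Primitive elements over finite fields\<close>

lemma finite_subfield_power_card:
  assumes "subfield_of F" "finite F" "x \<in> F"
  shows "x ^ card F = x"
proof (cases "x = 0")
  case True
  then show ?thesis using assms by (auto simp: card_gt_0_iff)
next
  case False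
  interpret F: subfield F by standard (rule assms)
  \<comment> \<open>Multiplication by \<open>x\<close> permutes the nonzero elements; comparing the
    products of all of them before and after gives \<open>x ^ card ?U = 1\<close>.\<close>
  let ?U = "F - {0}"
  have "(*) x ` ?U = ?U"
  proof
    show "(*) x ` ?U \<subseteq> ?U" using False assms F.mult_mem by auto
    show "?U \<subseteq> (*) x ` ?U"
    proof
      fix y assume "y \<in> ?U"
      then have "y = x * (inverse x * y)" "inverse x * y \<in> ?U"
        using False assms F.mult_mem F.inverse_mem by auto
      then show "y \<in> (*) x ` ?U" by blast
    qed
  qed
  then have "(\<Prod>y\<in>?U. y) = (\<Prod>y\<in>(*) x ` ?U. y)" by simp
  also have "\<dots> = (\<Prod>y\<in>?U. x * y)"
    using False by (subst prod.reindex) (auto simp: inj_on_def)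
  also have "\<dots> = x ^ card ?U * (\<Prod>y\<in>?U. y)" by (simp add: prod.distrib)
  finally have "x ^ card ?U = 1" using assms(2) by simp
  moreover have "card F = Suc (card ?U)" using assms(2) F.zero_mem by (metis card.remove)
  ultimately show ?thesis by (simp only: power_Suc mult_1_right)
qed

lemma (in subfield) card_span:
  assumes "finite K" "finite X" "K_independent K X"
  shows "finite (K_span K X) \<and> card (K_span K X) = card K ^ card X"
  using assms(2,3)
proof (induction X rule: finite_induct)
  case empty
  then show ?case by (simp add: span_empty)
next
  case (insert a X)
  then have a: "a \<notin> K_span K X" and IH: "finite (K_span K X)" "card (K_span K X) = card K ^ card X"
    using independent_insert by auto
  let ?f = "\<lambda>(k, x). k * a + x"
  have eq: "K_span K (insert a X) = ?f ` (K \<times> K_span K X)"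
    unfolding span_insert by force
  have "inj_on ?f (K \<times> K_span K X)"
  proof (rule inj_onI, clarify)
    fix k x l y assume *: "k \<in> K" "x \<in> K_span K X" "l \<in> K" "y \<in> K_span K X" "k * a + x = l * a + y"
    then have "(k - l) * a = y - x" by (simp add: algebra_simps)
    moreover have "y - x \<in> K_span K X" using * subspace_diff[OF subspace_span] by blast
    ultimately have "k - l = 0"
      using subspace_cancel_scale[OF subspace_span diff_mem[OF *(1,3)], of a X] a by auto
    then show "k = l \<and> x = y" using * by auto
  qed
  then show ?case
    unfolding eq using IH assms(1) insert.hyps by (simp add: card_image card_cartesian_product)
qed

lemma sum_powers_less: "2 \<le> q \<Longrightarrow> (\<Sum>j<n. q ^ j) < (q::nat) ^ n"
proof (induction n)
  case (Suc n)
  have "q ^ n + q ^ n \<le> q * q ^ n"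
    using mult_le_mono1[OF Suc.prems, of "q ^ n"] by linarith
  then show ?case using Suc by simp
qed simp

text \<open>Over a finite field, the elements \<open>\<gamma>\<close> with \<open>card (adj K \<gamma>) = q ^ j\<close> are roots of \<open>X ^ (q ^ j) - X\<close>,
  so those generating a proper subfield are too few to exhaust \<open>M\<close>.\<close>

lemma (in subfield) primitive_element_finite:
  assumes "finite K" and M: "subfield_of M" "K \<subseteq> M" "fin_dim K M"
  shows "\<exists>\<gamma>\<in>M. adj K \<gamma> = M"
proof (rule ccontr)
  assume no: "\<not> ?thesis"
  define q where "q = card K"
  have "card {0, 1::'a} \<le> q" unfolding q_def using assms(1) by (intro card_mono) auto
  then have q: "2 \<le> q" by simp
  have card_sub: "finite A \<and> card A = q ^ kdim K A" if A: "fin_dim K A" for A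
  proof -
    obtain X where "finite X" "K_basis K A X" "card X = kdim K A" by (rule basis_exists[OF A])
    then show ?thesis using card_span[OF assms(1), of X] by (auto simp: K_basis_def q_def)
  qed
  define R where "R j = {x::'a. x ^ (q ^ j) = x}" for j
  have R: "finite (R j) \<and> card (R j) \<le> q ^ j" if "j > 0" for j
  proof -
    define P :: "'a poly" where "P = monom 1 (q ^ j) - monom 1 1"
    have qj: "1 < q ^ j" using q that one_less_power[of q j] by simp
    have "coeff P (q ^ j) = 1" using qj by (simp add: P_def)
    then have "P \<noteq> 0" by auto
    have "degree P \<le> q ^ j" unfolding P_def using qj
      by (intro degree_diff_le) (auto simp: degree_monom_eq)
    moreover have "R j = {x. poly P x = 0}" by (auto simp: R_def P_def poly_monom)
    ultimately show ?thesis
      using poly_roots_finite[OF \<open>P \<noteq> 0\<close>] card_poly_roots_bound[OF \<open>P \<noteq> 0\<close>] by auto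
  qed
  define n where "n = kdim K M"
  have "M \<subseteq> (\<Union>j\<in>{0<..<n}. R j)"
  proof
    fix x assume x: "x \<in> M"
    have alg: "K_algebraic K x" using algebraic_if_mem M x by blast
    have sub: "adj K x \<subseteq> M" using adj_subset M x by blast
    have fin: "fin_dim K (adj K x)" using fin_dim_adj[OF alg] .
    have "x ^ card (adj K x) = x"
      using finite_subfield_power_card[OF subfield_adj[OF alg]] card_sub[OF fin] mem_adj by blast
    then have "x \<in> R (kdim K (adj K x))" using card_sub[OF fin] by (simp add: R_def)
    moreover have "kdim K (adj K x) < n"
      using no x subspace_eq_if_kdim_le[OF M(3) subspace_adj sub] unfolding n_def by (meson not_le)
    moreover have "0 < kdim K (adj K x)" using kdim_pos[OF fin subsetD[OF subset_adj one_mem]] by simp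
    ultimately show "x \<in> (\<Union>j\<in>{0<..<n}. R j)" by auto
  qed
  then have "card M \<le> card (\<Union>j\<in>{0<..<n}. R j)" using R by (intro card_mono) auto
  also have "\<dots> \<le> (\<Sum>j\<in>{0<..<n}. card (R j))" by (rule card_UN_le) simp
  also have "\<dots> \<le> (\<Sum>j\<in>{0<..<n}. q ^ j)" using R by (intro sum_mono) auto
  also have "\<dots> \<le> (\<Sum>j<n. q ^ j)" by (intro sum_mono2) auto
  also have "\<dots> < q ^ n" by (rule sum_powers_less[OF q])
  also have "\<dots> = card M" using card_sub[OF M(3)] by (simp add: n_def)
  finally show False by simp
qed

lemma (in subfield) primitive_element:
  assumes sep: "\<forall>x. K_algebraic K x \<longrightarrow> K_separable K x" and "K_algebraic K \<alpha>" "K_algebraic K \<beta>"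
  shows "\<exists>\<gamma>. K_algebraic K \<gamma> \<and> \<alpha> \<in> adj K \<gamma> \<and> \<beta> \<in> adj K \<gamma>"
proof (cases "finite K")
  case True
  obtain M where M: "subfield_of M" "fin_dim K M" "\<alpha> \<in> M" "\<beta> \<in> M" "K \<subseteq> M"
    by (rule algebraic_pair_extension[OF assms(2,3)])
  then show ?thesis using primitive_element_finite[OF True M(1,5,2)] algebraic_if_mem[OF M(2,1)] by blast
next
  case False
  obtain g where g: "K_min_poly K \<beta> g" using min_poly_exists[OF assms(3)] .
  then have g': "g \<in> polys K" "g \<noteq> 0" "poly g \<beta> = 0" by (auto simp: K_min_poly_iff)
  have "coprime g (pderiv g)" using sep assms(3) g by (auto simp: K_separable_def)
  \<comment> \<open>A double root of \<open>g\<close> would also be a root of its derivative,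
    against coprimality. This is the only form in which separability is used for infinite
    \<open>K\<close>.\<close>
  have "\<not> [:-\<beta>, 1:]\<^sup>2 dvd g"
  proof
    assume "[:-\<beta>, 1:]\<^sup>2 dvd g"
    then obtain h where h: "g = [:-\<beta>, 1:]\<^sup>2 * h" by blast
    define l where "l = [:-\<beta>, 1:]"
    have "pderiv l = 1" by (simp add: l_def pderiv_pCons)
    then have "pderiv (l * l * h) = l * (2 * h + l * pderiv h)"
      by (simp add: pderiv_mult algebra_simps)
    then have "pderiv g = [:-\<beta>, 1:] * (2 * h + [:-\<beta>, 1:] * pderiv h)"
      unfolding h power2_eq_square l_def .
    then have "[:-\<beta>, 1:] dvd pderiv g" by (metis dvd_triv_left)
    moreover have "[:-\<beta>, 1:] dvd g" using g'(3) by (simp add: poly_eq_0_iff_dvd)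
    ultimately have "is_unit [:-\<beta>, 1:]" using \<open>coprime g (pderiv g)\<close> coprime_common_divisor by blast
    then show False by (simp add: is_unit_poly_iff)
  qed
  then show ?thesis using primitive_element_infinite[OF False assms(2,3) g'] by blast
qed

subsection \<open>A linear Dyson transform\<close>

context subfield
begin

lemma subspace_prod_span: "K_subspace K (prod_span K A B)"
  unfolding prod_span_def by (rule subspace_span)

lemma prod_span_base: "a \<in> A \<Longrightarrow> b \<in> B \<Longrightarrow> a * b \<in> prod_span K A B"
  unfolding prod_span_def by (rule span_base) blast

lemma prod_span_minimal:
  assumes "K_subspace K C" "\<And>a b. a \<in> A \<Longrightarrow> b \<in> B \<Longrightarrow> a * b \<in> C"
  shows "prod_span K A B \<subseteq> C"
  unfolding prod_span_def using assms by (intro span_minimal) auto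

lemma prod_span_spans: "prod_span K (K_span K S) (K_span K T) = K_span K {x * y |x y. x \<in> S \<and> y \<in> T}"
  (is "_ = ?R")
proof
  have "x * y \<in> ?R" if "x \<in> S" "y \<in> K_span K T" for x y
  proof -
    have "y * x \<in> ?R" if "y \<in> T" for y
      using that \<open>x \<in> S\<close> by (intro span_base) (auto simp: mult.commute)
    then have "K_span K T \<subseteq> {y. y * x \<in> ?R}"
      by (intro span_minimal subspace_preimage_mult subspace_span) auto
    then show ?thesis using that by (auto simp: mult.commute)
  qed
  then have "K_span K S \<subseteq> {x. x * y \<in> ?R}" if "y \<in> K_span K T" for y
    using that by (intro span_minimal subspace_preimage_mult subspace_span) auto
  then show "prod_span K (K_span K S) (K_span K T) \<subseteq> ?R"
    by (intro prod_span_minimal subspace_span) blast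
  show "?R \<subseteq> prod_span K (K_span K S) (K_span K T)"
    using span_base by (intro span_minimal subspace_prod_span) (auto intro!: prod_span_base)
qed

lemma fin_dim_prod_span:
  assumes "fin_dim K A" "fin_dim K B"
  shows "fin_dim K (prod_span K A B)"
proof -
  obtain S where S: "finite S" "K_basis K A S" "card S = kdim K A" by (rule basis_exists[OF assms(1)])
  obtain T where T: "finite T" "K_basis K B T" "card T = kdim K B" by (rule basis_exists[OF assms(2)])
  have "{x * y |x y. x \<in> S \<and> y \<in> T} = (\<lambda>(x, y). x * y) ` (S \<times> T)" by auto
  then have "finite {x * y |x y. x \<in> S \<and> y \<in> T}" using S T by simp
  then show ?thesis
    using fin_dim_span prod_span_spans[of S T] S T by (auto simp: K_basis_def)
qed

text \<open>The linear analogue of Dyson's e-transform.\<close>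

lemma e_transform:
  assumes A: "fin_dim K A" and B: "fin_dim K B" and e: "e \<in> B" "e \<noteq> 0"
  defines "A' \<equiv> {a \<in> A. a * e \<in> B}" and "B' \<equiv> {b + c |b c. b \<in> B \<and> c \<in> (*) e ` A}"
  shows "fin_dim K A'" "fin_dim K B'" "kdim K A' + kdim K B' = kdim K A + kdim K B"
    "prod_span K A' B' \<subseteq> prod_span K A B"
proof -
  have sA: "K_subspace K A" and sB: "K_subspace K B" using A B by (auto simp: fin_dim_def)
  have A'_eq: "A' = A \<inter> {a. a * e \<in> B}" by (auto simp: A'_def)
  show fA': "fin_dim K A'"
    unfolding A'_eq using A subspace_preimage_mult[OF sB] by (rule fin_dim_Int)
  have fAe: "fin_dim K ((*) e ` A)" using fin_dim_image_mult[OF A] .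
  show "fin_dim K B'" unfolding B'_def using B fAe by (rule fin_dim_sums)
  \<comment> \<open>By the dimension formula for B + e A, whose two spaces intersect in e A', the
    second space gains exactly the dimension that the first one loses.\<close>
  have "B \<inter> (*) e ` A = (*) e ` A'" by (auto simp: A'_def mult.commute)
  then have "kdim K (B \<inter> (*) e ` A) = kdim K A'" using kdim_image_mult[OF fA' e(2)] by simp
  then show "kdim K A' + kdim K B' = kdim K A + kdim K B"
    using kdim_sums_Int[OF B fAe] kdim_image_mult[OF A e(2)] by (simp add: B'_def)
  show "prod_span K A' B' \<subseteq> prod_span K A B"
  proof (rule prod_span_minimal[OF subspace_prod_span])
    fix a b assume "a \<in> A'" "b \<in> B'"
    then obtain b' a' where b': "b = b' + e * a'" "b' \<in> B" "a' \<in> A" and a: "a \<in> A" "a * e \<in> B"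
      by (auto simp: A'_def B'_def)
    \<comment> \<open>By commutativity the factor \<open>e\<close> moves from \<open>a'\<close> to
      \<open>a\<close>, where it gives an element of \<open>B\<close>.\<close>
    have "a * b = a * b' + a' * (a * e)" by (simp add: b' algebra_simps)
    then show "a * b \<in> prod_span K A B"
      using subspace_add[OF subspace_prod_span prod_span_base[OF a(1) b'(2)] prod_span_base[OF b'(3) a(2)]]
      by simp
  qed
qed

text \<open>If A B is contained in B, then A is contained in \<open>stab B\<close>, and V = B, H =
  \<open>stab B\<close> satisfy the inequality. Otherwise the transform at some e with
  \<open>a * e\<close> outside B strictly shrinks A, enlarges B, keeps the sum of dimensions and
  stays inside the product span, so H and V of the new pair serve for the old one. The normalization
  1 in A survives because e lies in B; it gives B inside the product span in the first case.\<close>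

lemma stable_subspace_of_product:
  assumes "fin_dim K A" "fin_dim K B" "1 \<in> A" "B \<noteq> {0}"
  shows "\<exists>H V. subfield_of H \<and> K \<subseteq> H \<and> fin_dim K H \<and> fin_dim K V \<and> B \<subseteq> V \<and> V \<subseteq> prod_span K A B \<and>
    (\<forall>h\<in>H. \<forall>v\<in>V. h * v \<in> V) \<and> kdim K A + kdim K B \<le> kdim K V + kdim K H"
  using assms
proof (induction "kdim K A" arbitrary: A B rule: less_induct)
  case less
  have sA: "K_subspace K A" and sB: "K_subspace K B" using less.prems by (auto simp: fin_dim_def)
  obtain v where v: "v \<in> B" "v \<noteq> 0" using less.prems(4) subspace_zero[OF sB] by blast
  show ?case
  proof (cases "\<forall>a\<in>A. \<forall>e\<in>B. a * e \<in> B")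
    case True
    let ?H = "stab B"
    have "A \<subseteq> ?H" using True by (auto simp: stab_def)
    then have "kdim K A \<le> kdim K ?H" using kdim_mono[OF fin_dim_stab[OF less.prems(2) v] sA] by blast
    moreover have "B \<subseteq> prod_span K A B" using prod_span_base[OF less.prems(3), of _ B] by auto
    ultimately show ?thesis
      using subfield_stab[OF less.prems(2) v] subset_stab[OF less.prems(2) v] fin_dim_stab[OF less.prems(2) v]
        less.prems(2) by (intro exI[of _ ?H] exI[of _ B]) (auto simp: stab_def)
  next
    case False
    then obtain a e where ae: "a \<in> A" "e \<in> B" "a * e \<notin> B" by blast
    then have e0: "e \<noteq> 0" using subspace_zero[OF sB] by auto
    define A' where "A' = {a \<in> A. a * e \<in> B}"
    define B' where "B' = {b + c |b c. b \<in> B \<and> c \<in> (*) e ` A}"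
    note tr = e_transform[OF less.prems(1,2) ae(2) e0, folded A'_def B'_def]
    have lt: "kdim K A' < kdim K A"
    proof (rule ccontr)
      assume "\<not> kdim K A' < kdim K A"
      then have "A' = A"
        using subspace_eq_if_kdim_le[OF less.prems(1) fin_dim_subspace[OF tr(1)]] A'_def by auto
      then show False using ae A'_def by blast
    qed
    have "B \<subseteq> B'"
    proof
      fix b assume "b \<in> B"
      then have "b = b + e * 0" "e * 0 \<in> (*) e ` A" using subspace_zero[OF sA] by auto
      then show "b \<in> B'" unfolding B'_def using \<open>b \<in> B\<close> by blast
    qed
    moreover from this have "B' \<noteq> {0}" using v by blast
    moreover have "1 \<in> A'" using less.prems(3) ae by (simp add: A'_def)
    ultimately obtain H V where HV: "subfield_of H" "K \<subseteq> H" "fin_dim K H" "fin_dim K V" "B' \<subseteq> V"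
      "V \<subseteq> prod_span K A' B'" "\<forall>h\<in>H. \<forall>v\<in>V. h * v \<in> V" "kdim K A' + kdim K B' \<le> kdim K V + kdim K H"
      using less.hyps[OF lt tr(1,2)] by blast
    then have "B \<subseteq> V" "V \<subseteq> prod_span K A B" "kdim K A + kdim K B \<le> kdim K V + kdim K H"
      using \<open>B \<subseteq> B'\<close> tr(3,4) by auto
    then show ?thesis using HV by blast
  qed
qed

text \<open>Dividing A by \<open>a\<close> brings 1 into it; multiplying V by \<open>a\<close>
  afterwards preserves stability under H and all dimensions.\<close>

lemma stable_subspace_of_product_at:
  assumes A: "fin_dim K A" and B: "fin_dim K B" "B \<noteq> {0}" and a: "a \<in> A" "a \<noteq> 0"
  shows "\<exists>H V. subfield_of H \<and> K \<subseteq> H \<and> fin_dim K H \<and> fin_dim K V \<and> (\<forall>b\<in>B. a * b \<in> V) \<and> V \<subseteq> prod_span K A B \<and>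
    (\<forall>h\<in>H. \<forall>v\<in>V. h * v \<in> V) \<and> kdim K A + kdim K B \<le> kdim K V + kdim K H"
proof -
  let ?A = "(*) (inverse a) ` A"
  have fA: "fin_dim K ?A" "kdim K ?A = kdim K A"
    using fin_dim_image_mult[OF A] kdim_image_mult[OF A, of "inverse a"] a by auto
  have "1 \<in> ?A" using a by (auto intro!: image_eqI[of _ _ a])
  then obtain H V where HV: "subfield_of H" "K \<subseteq> H" "fin_dim K H" "fin_dim K V" "B \<subseteq> V"
      "V \<subseteq> prod_span K ?A B" "\<forall>h\<in>H. \<forall>v\<in>V. h * v \<in> V" "kdim K ?A + kdim K B \<le> kdim K V + kdim K H"
    using stable_subspace_of_product[OF fA(1) B(1) _ B(2)] by blast
  let ?V = "(*) a ` V"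
  have "fin_dim K ?V" "kdim K ?V = kdim K V"
    using fin_dim_image_mult[OF HV(4)] kdim_image_mult[OF HV(4) a(2)] by auto
  moreover have "prod_span K ?A B \<subseteq> {x. x * a \<in> prod_span K A B}"
  proof (rule prod_span_minimal[OF subspace_preimage_mult[OF subspace_prod_span]])
    fix x b assume "x \<in> ?A" "b \<in> B"
    then obtain a' where "x = inverse a * a'" "a' \<in> A" by blast
    then have "x * b * a = a' * b" using a(2) by simp
    then show "x * b \<in> {x. x * a \<in> prod_span K A B}"
      using prod_span_base[OF \<open>a' \<in> A\<close> \<open>b \<in> B\<close>] by (simp only: mem_Collect_eq)
  qed
  then have "?V \<subseteq> prod_span K A B" using HV(6) by (auto simp: mult.commute)
  moreover have "\<forall>h\<in>H. \<forall>v\<in>?V. h * v \<in> ?V" using HV(7) by (auto simp: mult.left_commute[of _ a])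
  moreover have "\<forall>b\<in>B. a * b \<in> ?V" using HV(5) by blast
  ultimately show ?thesis using HV fA(2) by (intro exI[of _ H] exI[of _ ?V]) auto
qed

text \<open>Takes the place of inverting a Vandermonde matrix. The quotient of p(x) - p(c) by x - c
  has smaller degree and again takes values in \<open>W\<close> at the points of \<open>Z\<close>
  other than c, because x - c is a nonzero scalar. The coefficients of \<open>p\<close> are
  recovered from those of the quotient and p(c).\<close>

lemma coeffs_in_subspace_if_values:
  assumes W: "K_subspace K W" and "Z \<subseteq> K" "infinite Z" "\<And>c. c \<in> Z \<Longrightarrow> poly p c \<in> W"
  shows "coeff p i \<in> W"
  using assms(2-4)
proof (induction "degree p" arbitrary: p Z i rule: less_induct)
  case less
  show ?case
  proof (cases "degree p = 0")
    case True
    then obtain a where a: "p = [:a:]" by (rule degree_eq_zeroE)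
    obtain c where "c \<in> Z" using less.prems(2) by fastforce
    then have "a \<in> W" using less.prems(3)[of c] a by simp
    then show ?thesis using a subspace_zero[OF W] by (auto simp: coeff_pCons split: nat.split)
  next
    case False
    obtain c where c: "c \<in> Z" using less.prems(2) by fastforce
    define s where "s = synthetic_div p c"
    have eq: "p + smult c s = pCons (poly p c) s" unfolding s_def by (rule synthetic_div_correct)
    have "poly s x \<in> W" if x: "x \<in> Z - {c}" for x
    proof -
      have "poly p x + c * poly s x = poly p c + x * poly s x"
        using arg_cong[OF eq, of "\<lambda>q. poly q x"] by simp
      then have "(x - c) * poly s x = poly p x - poly p c" by (simp add: algebra_simps)
      moreover have "poly p x - poly p c \<in> W" using less.prems(3) x c subspace_diff[OF W] by blast
      ultimately show ?thesis
        using subspace_cancel_scale[OF W diff_mem, of x c "poly s x"] x c less.prems(1) by auto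
    qed
    moreover have "degree s < degree p" using False by (simp add: s_def degree_synthetic_div)
    ultimately have s: "coeff s j \<in> W" for j
      using less.hyps[of s "Z - {c}" j] less.prems by auto
    have "coeff (pCons (poly p c) s) i \<in> W"
      using s less.prems(3)[OF c] by (cases i) (auto simp: coeff_pCons)
    moreover have "c * coeff s i \<in> W" using s subspace_scale[OF W] c less.prems(1) by blast
    moreover have "coeff p i = coeff (pCons (poly p c) s) i - c * coeff s i"
      using arg_cong[OF eq, of "\<lambda>q. coeff q i"] by (simp add: algebra_simps)
    ultimately show ?thesis using subspace_diff[OF W] by simp
  qed
qed

text \<open>For \<open>c \<in> K\<close> the elements \<open>\<Sum> c ^ i * a\<^sub>i\<close> on the moment curve of a basis \<open>a\<^sub>i\<close> of \<open>A\<close> all have a stable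
  subspace; infinitely many of them share the same subfield \<open>H\<close>, and any infinite set of points of the
  curve spans \<open>A\<close>, so \<open>H\<close> stabilizes all of the product.\<close>

lemma kneser_infinite:
  assumes "infinite K" and A: "fin_dim K A" "A \<noteq> {0}" and B: "fin_dim K B" "B \<noteq> {0}"
    and fin: "finite {H. subfield_of H \<and> K \<subseteq> H \<and>
      (\<exists>v\<in>prod_span K A B. v \<noteq> 0 \<and> (\<forall>h\<in>H. h * v \<in> prod_span K A B))}" (is "finite ?HH")
  shows "kdim K A + kdim K B \<le> kdim K (prod_span K A B) + kdim K (stab (prod_span K A B))"
proof -
  define C where "C = prod_span K A B"
  have sA: "K_subspace K A" and sB: "K_subspace K B" using A B by (auto simp: fin_dim_def)
  have fC: "fin_dim K C" unfolding C_def using fin_dim_prod_span A B by blast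
  have sC: "K_subspace K C" using fC fin_dim_def by blast
  obtain b0 where b0: "b0 \<in> B" "b0 \<noteq> 0" using B subspace_zero[OF sB] by blast
  obtain X where X: "finite X" "K_basis K A X" "card X = kdim K A" by (rule basis_exists[OF A(1)])
  obtain xs where xs: "set xs = X" "distinct xs" using finite_distinct_list[OF X(1)] by blast
  \<comment> \<open>The basis vectors become the coefficients of one polynomial over the large
    field; its values at elements of \<open>K\<close> are the points of the moment curve.\<close>
  define p where "p = Poly xs"
  have coeff_p: "coeff p i \<in> A" for i
  proof -
    have "coeff p i \<in> insert 0 (set xs)"
      by (cases "i < length xs") (auto simp: p_def nth_default_def)
    moreover have "X \<subseteq> A" using X by (simp add: K_basis_def)
    ultimately show ?thesis using xs(1) subspace_zero[OF sA] by auto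
  qed
  have p_coeff: "x \<in> range (coeff p)" if "x \<in> X" for x
  proof -
    have "x \<in> set xs" using that xs by simp
    then obtain i where "i < length xs" "xs ! i = x" unfolding in_set_conv_nth by blast
    then have "coeff p i = x" by (simp add: p_def nth_default_nth)
    then show ?thesis by blast
  qed
  have pA: "poly p c \<in> A" if "c \<in> K" for c
  proof -
    have "poly p c = (\<Sum>i\<le>degree p. c ^ i * coeff p i)" by (simp add: poly_altdef mult.commute)
    also have "\<dots> \<in> A"
      by (intro subspace_sum[OF sA] subspace_scale[OF sA] power_mem coeff_p that)
    finally show ?thesis .
  qed
  have "p \<noteq> 0"
  proof
    assume "p = 0"
    then have "X \<subseteq> {0}" using p_coeff by auto
    then have "A \<subseteq> {0}" using X span_minimal[OF subspace_bot, of X] by (auto simp: K_basis_def)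
    then show False using A(2) subspace_zero[OF sA] by blast
  qed
  \<comment> \<open>Parameters with \<open>poly p c = 0\<close> are dropped:
    \<open>stable_subspace_of_product_at\<close> requires a nonzero element, and
    \<open>poly p c * b0\<close> has to be a nonzero witness placing \<open>Hf c\<close> in the
    finite family.\<close>
  define K' where "K' = K - {c. poly p c = 0}"
  have K': "infinite K'" unfolding K'_def using assms(1) poly_roots_finite[OF \<open>p \<noteq> 0\<close>] by simp
  define P where "P c HV \<longleftrightarrow> (case HV of (H, V) \<Rightarrow> subfield_of H \<and> K \<subseteq> H \<and> fin_dim K H \<and> fin_dim K V \<and>
      (\<forall>b\<in>B. poly p c * b \<in> V) \<and> V \<subseteq> C \<and> (\<forall>h\<in>H. \<forall>v\<in>V. h * v \<in> V) \<and>
      kdim K A + kdim K B \<le> kdim K V + kdim K H)" for c HV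
  have "\<exists>HV. P c HV" if "c \<in> K'" for c
    using stable_subspace_of_product_at[OF A(1) B, of "poly p c"] pA[of c] that
    unfolding P_def K'_def C_def by auto
  then obtain f where f: "\<And>c. c \<in> K' \<Longrightarrow> P c (f c)" by metis
  define Hf where "Hf c = fst (f c)" for c
  define Vf where "Vf c = snd (f c)" for c
  have f': "subfield_of (Hf c)" "K \<subseteq> Hf c" "fin_dim K (Hf c)" "fin_dim K (Vf c)"
      "\<And>b. b \<in> B \<Longrightarrow> poly p c * b \<in> Vf c" "Vf c \<subseteq> C" "\<And>h v. h \<in> Hf c \<Longrightarrow> v \<in> Vf c \<Longrightarrow> h * v \<in> Vf c"
      "kdim K A + kdim K B \<le> kdim K (Vf c) + kdim K (Hf c)" if "c \<in> K'" for c
    using f[OF that] by (auto simp: P_def Hf_def Vf_def split: prod.splits)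
  have "Hf ` K' \<subseteq> ?HH"
  proof (rule image_subsetI)
    fix c assume c: "c \<in> K'"
    let ?v = "poly p c * b0"
    have "?v \<noteq> 0" using c b0 by (simp add: K'_def)
    moreover have "?v \<in> C" "\<forall>h\<in>Hf c. h * ?v \<in> C" using f'(5-7)[OF c] b0 by blast+
    ultimately show "Hf c \<in> ?HH" using f'(1,2)[OF c] unfolding C_def by blast
  qed
  then have "finite (Hf ` K')" using fin finite_subset by blast
  then obtain c0 where c0: "c0 \<in> K'" and inf: "infinite {c \<in> K'. Hf c = Hf c0}"
    using pigeonhole_infinite[OF K'] by blast
  define Z where "Z = {c \<in> K'. Hf c = Hf c0}"
  have hab: "h * (a * b) \<in> C" if h: "h \<in> Hf c0" and ab: "a \<in> A" "b \<in> B" for h a b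
  proof -
    \<comment> \<open>For fixed \<open>h\<close> and \<open>b\<close> the condition on
      \<open>a\<close> is linear over \<open>K\<close>, so it passes from infinitely many points of
      the curve to the coefficients of \<open>p\<close>, that is, to a basis of
      \<open>A\<close>.\<close>
    define W where "W = {x. x * (h * b) \<in> C}"
    have W: "K_subspace K W" unfolding W_def by (rule subspace_preimage_mult[OF sC])
    have "poly p c \<in> W" if "c \<in> Z" for c
    proof -
      have c: "c \<in> K'" "h \<in> Hf c" using that h by (auto simp: Z_def)
      have "h * (poly p c * b) \<in> C" using f'(5-7)[OF c(1)] c ab by blast
      then show ?thesis by (simp add: W_def mult_ac)
    qed
    then have "coeff p i \<in> W" for i
      using coeffs_in_subspace_if_values[OF W, of Z p i] inf by (auto simp: Z_def K'_def)
    then have "X \<subseteq> W" using p_coeff by blast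
    then have "A \<subseteq> W" using X span_minimal[OF W, of X] by (auto simp: K_basis_def)
    then show ?thesis using ab by (auto simp: W_def mult_ac)
  qed
  have "prod_span K A B \<subseteq> {x. x * h \<in> C}" if "h \<in> Hf c0" for h
    by (rule prod_span_minimal[OF subspace_preimage_mult[OF sC]])
      (use hab[OF that] in \<open>simp add: mult.commute[of _ h]\<close>)
  then have "C \<subseteq> {x. x * h \<in> C}" if "h \<in> Hf c0" for h using that by (simp add: C_def)
  then have "Hf c0 \<subseteq> stab C" by (auto simp: stab_def mult.commute)
  moreover have "poly p c0 * b0 \<in> C" "poly p c0 * b0 \<noteq> 0"
    using f'(5,6)[OF c0] b0 c0 by (auto simp: K'_def)
  ultimately have "kdim K (Hf c0) \<le> kdim K (stab C)"
    using kdim_mono[OF fin_dim_stab[OF fC]] fin_dim_subspace[OF f'(3)[OF c0]] by blast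
  moreover have "kdim K (Vf c0) \<le> kdim K C"
    using kdim_mono[OF fC fin_dim_subspace[OF f'(4)[OF c0]] f'(6)[OF c0]] .
  ultimately show ?thesis using f'(8)[OF c0] unfolding C_def by linarith
qed

end

subsection \<open>Passage to Laurent series\<close>

unbundle fps_syntax

text \<open>For the subfield \<open>K\<close> this is K((t)) inside L((t)). For a finite-dimensional
  subspace it is the scalar extension from K to K((t)), as \<open>ext_span\<close> shows.\<close>

definition ext :: "'a::field set \<Rightarrow> 'a fls set" where
  "ext A = {f. \<forall>n. f $$ n \<in> A}"

lemma extD: "f \<in> ext A \<Longrightarrow> f $$ n \<in> A"
  by (simp add: ext_def)

lemma ext_mono: "A \<subseteq> B \<Longrightarrow> ext A \<subseteq> ext B"
  by (auto simp: ext_def)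

lemma const_mem_ext: "0 \<in> A \<Longrightarrow> fls_const a \<in> ext A \<longleftrightarrow> a \<in> A"
  by (auto simp: ext_def dest: spec[of _ 0])

context subfield
begin

lemma ext_mult:
  assumes "K_subspace K C" "f \<in> ext A" "g \<in> ext B" "\<And>a b. a \<in> A \<Longrightarrow> b \<in> B \<Longrightarrow> a * b \<in> C"
  shows "f * g \<in> ext C"
proof -
  have "(f * g) $$ n \<in> C" for n
    unfolding fls_times_nth(2)[of f g n] using extD[OF assms(2)] extD[OF assms(3)] assms(4)
    by (intro subspace_sum[OF assms(1)]) auto
  then show ?thesis by (simp add: ext_def)
qed

text \<open>The equation \<open>f * g = 1\<close> is a recursion for the coefficients of the inverse
  \<open>g\<close> whose only divisor is the leading coefficient of \<open>f\<close>, an element of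
  \<open>K\<close>.\<close>

lemma inverse_mem_ext:
  assumes f: "f \<in> ext K"
  shows "inverse f \<in> ext K"
proof (cases "f = 0")
  case True
  then show ?thesis using f by simp
next
  case False
  define g where "g = inverse f"
  define d where "d = fls_subdegree f"
  have fg: "f * g = 1" using False by (simp add: g_def)
  have "g \<noteq> 0" using False by (simp add: g_def)
  then have "d + fls_subdegree g = 0"
    using fls_subdegree_mult[OF False, of g] fg by (simp add: d_def)
  then have dg: "fls_subdegree g = - d" by simp
  have "g $$ (int m - d) \<in> K" for m
  proof (induction m rule: less_induct)
    case (less m)
    have "(f * g) $$ int m = (\<Sum>i=0..int m. f $$ (d + i) * g $$ (int m - d - i))"
      using fls_times_nth(4)[of f g "int m"] dg by (simp add: d_def)
    also have "\<dots> = f $$ d * g $$ (int m - d) + (\<Sum>i\<in>{0..int m} - {0}. f $$ (d + i) * g $$ (int m - d - i))"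
      by (subst sum.remove[of _ 0]) auto
    finally have eq: "f $$ d * g $$ (int m - d)
        = 1 $$ int m - (\<Sum>i\<in>{0..int m} - {0}. f $$ (d + i) * g $$ (int m - d - i))"
      using fg by (simp add: algebra_simps)
    have "f $$ (d + i) * g $$ (int m - d - i) \<in> K" if "i \<in> {0..int m} - {0}" for i
    proof -
      have "int m - d - i = int (nat (int m - i)) - d" "nat (int m - i) < m" using that by auto
      then show ?thesis using less extD[OF f] mult_mem by metis
    qed
    then have "f $$ d * g $$ (int m - d) \<in> K"
      unfolding eq by (intro diff_mem sum_mem) auto
    moreover have "f $$ d \<noteq> 0" using False by (simp add: d_def)
    ultimately show ?case using subspace_cancel_scale[OF subspace_self extD[OF f]] by blast
  qed
  then have "g $$ n \<in> K" for n
  proof (cases "n < - d")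
    case True
    then show ?thesis using dg by simp
  next
    case False
    then have "n = int (nat (n + d)) - d" by simp
    then show ?thesis using \<open>\<And>m. g $$ (int m - d) \<in> K\<close> by metis
  qed
  then show ?thesis by (simp add: ext_def g_def)
qed

lemma subfield_ext: "subfield_of (ext K)"
  unfolding subfield_of_def
proof (intro conjI ballI)
  fix f g :: "'a fls" assume fg: "f \<in> ext K" "g \<in> ext K"
  show "f * g \<in> ext K" using ext_mult[OF subspace_self fg] mult_mem by blast
  show "f + g \<in> ext K" using fg add_mem by (simp add: ext_def)
qed (auto simp: inverse_mem_ext, auto simp: ext_def uminus_mem)

text \<open>The powers of 1/t already suffice, whatever the size of \<open>K\<close>; this makes
  \<open>kneser_infinite\<close> applicable over series.\<close>

lemma infinite_ext: "infinite (ext K)"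
proof -
  let ?f = "\<lambda>n::nat. fls_shift (int n) (1 :: 'a fls)"
  have "inj ?f"
  proof (rule injI)
    fix m n :: nat assume "?f m = ?f n"
    then have "?f m $$ (- int m) = ?f n $$ (- int m)" by simp
    then show "m = n" by (simp split: if_splits)
  qed
  then have "infinite (range ?f)" using finite_imageD by blast
  moreover have "range ?f \<subseteq> ext K" by (auto simp: ext_def)
  ultimately show ?thesis using finite_subset by blast
qed

lemma ext_span_insert:
  "ext (K_span K (insert a X)) = {k * fls_const a + x |k x. k \<in> ext K \<and> x \<in> ext (K_span K X)}"
proof (intro equalityI subsetI)
  fix f assume f: "f \<in> ext (K_span K (insert a X))"
  \<comment> \<open>The scalars are chosen one coefficient at a time. Demanding \<open>k = 0\<close>
    where \<open>f $$ n\<close> vanishes makes the family zero below the subdegree of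
    \<open>f\<close>, so that it is a Laurent series.\<close>
  have "\<forall>n. \<exists>k\<in>K. f $$ n - k * a \<in> K_span K X \<and> (f $$ n = 0 \<longrightarrow> k = 0)"
  proof
    fix n
    show "\<exists>k\<in>K. f $$ n - k * a \<in> K_span K X \<and> (f $$ n = 0 \<longrightarrow> k = 0)"
    proof (cases "f $$ n = 0")
      case True
      then show ?thesis using subspace_zero[OF subspace_span] by (intro bexI[of _ 0]) auto
    next
      case False
      have "f $$ n \<in> K_span K (insert a X)" using f by (rule extD)
      then obtain k x where "f $$ n = k * a + x" "k \<in> K" "x \<in> K_span K X"
        unfolding span_insert by blast
      then show ?thesis using False by (intro bexI[of _ k]) auto
    qed
  qed
  then obtain k where k: "\<And>n. k n \<in> K" "\<And>n. f $$ n - k n * a \<in> K_span K X" "\<And>n. f $$ n = 0 \<Longrightarrow> k n = 0"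
    by metis
  define kf where "kf = Abs_fls k"
  have kf: "kf $$ n = k n" for n
    unfolding kf_def by (rule nth_Abs_fls_lower_bound[of "fls_subdegree f"]) (simp add: k(3))
  have "f = kf * fls_const a + (f - kf * fls_const a)" by simp
  moreover have "kf \<in> ext K" using k by (simp add: ext_def kf)
  moreover have "f - kf * fls_const a \<in> ext (K_span K X)" using k by (simp add: ext_def kf)
  ultimately show "f \<in> {k * fls_const a + x |k x. k \<in> ext K \<and> x \<in> ext (K_span K X)}" by blast
next
  fix f assume "f \<in> {k * fls_const a + x |k x. k \<in> ext K \<and> x \<in> ext (K_span K X)}"
  then obtain k x where f: "f = k * fls_const a + x" "k \<in> ext K" "x \<in> ext (K_span K X)" by blast
  show "f \<in> ext (K_span K (insert a X))"
    unfolding ext_def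
  proof (intro CollectI allI)
    fix n
    have "f $$ n = k $$ n * a + x $$ n" by (simp add: f)
    then show "f $$ n \<in> K_span K (insert a X)"
      unfolding span_insert using extD[OF f(2)] extD[OF f(3)] by blast
  qed
qed

lemma ext_span: "finite X \<Longrightarrow> ext (K_span K X) = K_span (ext K) (fls_const ` X)"
proof (induction X rule: finite_induct)
  case empty
  interpret E: subfield "ext K" by standard (rule subfield_ext)
  have "ext {0} = {0 :: 'a fls}" by (auto simp: ext_def intro: fls_eqI)
  then show ?case by (simp add: span_empty E.span_empty)
next
  case (insert a X)
  interpret E: subfield "ext K" by standard (rule subfield_ext)
  show ?case using insert.IH by (simp only: ext_span_insert image_insert E.span_insert)
qed

lemma independent_ext: "finite X \<Longrightarrow> K_independent K X \<Longrightarrow> K_independent (ext K) (fls_const ` X)"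
proof (induction X rule: finite_induct)
  case empty
  interpret E: subfield "ext K" by standard (rule subfield_ext)
  show ?case by (simp add: E.independent_empty)
next
  case (insert a X)
  interpret E: subfield "ext K" by standard (rule subfield_ext)
  have "a \<notin> K_span K X" "K_independent K X" using insert independent_insert by auto
  then have "fls_const a \<notin> K_span (ext K) (fls_const ` X)"
    using const_mem_ext[OF subspace_zero[OF subspace_span]] ext_span[OF insert.hyps(1)] by metis
  moreover from this have "fls_const a \<notin> fls_const ` X" using E.span_superset by blast
  ultimately show ?case
    using insert.IH[OF \<open>K_independent K X\<close>] unfolding image_insert by (simp only: E.independent_insert simp_thms)
qed

lemma
  assumes "fin_dim K A"
  shows fin_dim_ext: "fin_dim (ext K) (ext A)"
    and kdim_ext: "kdim (ext K) (ext A) = kdim K A"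
proof -
  interpret E: subfield "ext K" by standard (rule subfield_ext)
  obtain X where X: "finite X" "K_basis K A X" "card X = kdim K A" by (rule basis_exists[OF assms])
  have A: "ext A = K_span (ext K) (fls_const ` X)" using ext_span[OF X(1)] X by (simp add: K_basis_def)
  show "fin_dim (ext K) (ext A)" unfolding A using X(1) by (intro E.fin_dim_span) auto
  have "K_basis (ext K) (ext A) (fls_const ` X)"
    using independent_ext[OF X(1)] X E.span_superset A by (auto simp: K_basis_def)
  then have "kdim (ext K) (ext A) = card (fls_const ` X)" using X by (intro E.kdim_eq_card) auto
  also have "\<dots> = card X" by (intro card_image inj_onI) (metis fls_const_nth)
  finally show "kdim (ext K) (ext A) = kdim K A" using X by simp
qed

lemma prod_span_ext:
  assumes "fin_dim K A" "fin_dim K B"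
  shows "prod_span (ext K) (ext A) (ext B) = ext (prod_span K A B)"
proof -
  interpret E: subfield "ext K" by standard (rule subfield_ext)
  obtain S where S: "finite S" "K_basis K A S" "card S = kdim K A" by (rule basis_exists[OF assms(1)])
  obtain T where T: "finite T" "K_basis K B T" "card T = kdim K B" by (rule basis_exists[OF assms(2)])
  have A: "A = K_span K S" and B: "B = K_span K T" using S T by (auto simp: K_basis_def)
  have "{x * y |x y. x \<in> S \<and> y \<in> T} = (\<lambda>(x, y). x * y) ` (S \<times> T)" by auto
  then have fin: "finite {x * y |x y. x \<in> S \<and> y \<in> T}" using S T by simp
  have "{x * y |x y. x \<in> fls_const ` S \<and> y \<in> fls_const ` T} = fls_const ` {x * y |x y. x \<in> S \<and> y \<in> T}"
    by (force simp flip: fls_const_mult_const)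
  then show ?thesis
    unfolding A B ext_span[OF S(1)] ext_span[OF T(1)] E.prod_span_spans prod_span_spans
      ext_span[OF fin] by simp
qed

text \<open>Testing a multiplier on constant series constrains each of its coefficients separately.
  The inclusion bounds the stabilizer term of the inequality over series by the one over
  \<open>K\<close>.\<close>

lemma stab_ext_subset:
  assumes "0 \<in> C"
  shows "stab (ext C) \<subseteq> ext (stab C)"
proof
  fix f assume f: "f \<in> stab (ext C)"
  have "f $$ n * c \<in> C" if "c \<in> C" for n c
  proof -
    have "f * fls_const c \<in> ext C" using f that const_mem_ext[OF assms] by (auto simp: stab_def)
    then show ?thesis using extD[of "f * fls_const c" C n] by simp
  qed
  then show "f \<in> ext (stab C)" by (simp add: ext_def stab_def)
qed

text \<open>A Newton polygon argument. Let j be the subdegree and c the leading coefficient of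
  \<open>g\<close>, and let m be the least subdegree of the terms \<open>coeff q k * g ^ k\<close>.
  Only the terms attaining m contribute to the coefficient of t^m in q(g) = 0, and that coefficient
  is the value at c of a nonzero polynomial over \<open>K\<close>.\<close>

lemma algebraic_leading_coeff:
  assumes q: "q \<in> polys (ext K)" "q \<noteq> 0" "poly q g = 0" and g: "g \<noteq> 0"
  shows "K_algebraic K (g $$ fls_subdegree g)"
proof -
  define j where "j = fls_subdegree g"
  define c where "c = g $$ j"
  define S where "S = {k. k \<le> degree q \<and> coeff q k \<noteq> 0}"
  define val where "val k = fls_subdegree (coeff q k) + int k * j" for k
  define m where "m = Min (val ` S)"
  have S: "finite S" "degree q \<in> S" using q(2) by (auto simp: S_def)
  then have m: "m \<in> val ` S" "\<And>k. k \<in> S \<Longrightarrow> m \<le> val k" unfolding m_def by (auto intro!: Min_in)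
  \<comment> \<open>The entry at \<open>k\<close> is the leading coefficient of
    \<open>coeff q k\<close> if the term attains \<open>m\<close>. Otherwise it is 0, since
    \<open>m - int k * j\<close> lies below the subdegree or \<open>coeff q k\<close>
    vanishes.\<close>
  define Q where "Q = (\<Sum>k\<le>degree q. monom (coeff q k $$ (m - int k * j)) k)"
  have coeff_Q: "coeff Q k = (if k \<le> degree q then coeff q k $$ (m - int k * j) else 0)" for k
    by (simp add: Q_def coeff_sum)
  have nth_m: "(coeff q k * g ^ k) $$ m = coeff q k $$ (m - int k * j) * c ^ k" if "k \<le> degree q" for k
  proof (cases "coeff q k = 0")
    case False
    have sub: "fls_subdegree (g ^ k) = int k * j" by (simp add: fls_subdegree_pow j_def)
    have base: "g ^ k $$ (int k * j) = c ^ k"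
      using fls_pow_base[of g k] by (simp add: j_def c_def)
    have "m \<le> val k" using m False that by (auto simp: S_def)
    then consider "m = val k" | "m < val k" by linarith
    then show ?thesis
    proof cases
      case 1
      then show ?thesis using fls_times_base[of "coeff q k" "g ^ k"] sub base by (simp add: val_def)
    next
      case 2
      then show ?thesis using fls_times_nth_eq0[of m "coeff q k" "g ^ k"] sub by (simp add: val_def)
    qed
  qed simp
  have "poly Q c = (\<Sum>k\<le>degree q. coeff q k $$ (m - int k * j) * c ^ k)"
    by (simp add: Q_def poly_sum poly_monom)
  also have "\<dots> = (\<Sum>k\<le>degree q. (coeff q k * g ^ k) $$ m)" using nth_m by (intro sum.cong) auto
  also have "\<dots> = poly q g $$ m" by (simp add: poly_altdef fls_nth_sum)
  finally have "poly Q c = 0" using q(3) by simp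
  moreover have "Q \<noteq> 0"
  proof -
    obtain k where k: "k \<in> S" "m = val k" using m(1) by blast
    then have "coeff Q k = coeff q k $$ fls_subdegree (coeff q k)"
      by (simp add: coeff_Q S_def val_def)
    then have "coeff Q k \<noteq> 0" using k by (simp add: S_def)
    then show ?thesis by auto
  qed
  moreover have "Q \<in> polys K" using q(1) by (auto simp: polys_def coeff_Q intro: extD)
  ultimately show ?thesis unfolding K_algebraic_iff c_def j_def by blast
qed

text \<open>The coefficients of \<open>f\<close> are treated in order. Once those before index n lie
  in \<open>K\<close>, their truncation \<open>e\<close> is in \<open>ext K\<close>, and f - e is
  still algebraic and still carries \<open>v\<close> into \<open>ext D\<close>. If nonzero, the
  coefficient of \<open>f\<close> at n is the leading one of f - e: it is algebraic over
  \<open>K\<close> and carries the leading coefficient of \<open>v\<close> into \<open>D\<close>, so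
  \<open>P\<close> applies. The lemma is used with \<open>adj K \<theta>\<close> in the place of
  \<open>K\<close>.\<close>

lemma mem_ext_if_leading_coeffs:
  assumes D: "K_subspace K D" and f: "K_algebraic (ext K) f"
    and v: "v \<in> ext D" "v \<noteq> 0" "f * v \<in> ext D"
    and P: "\<And>x d. d \<in> D \<Longrightarrow> d \<noteq> 0 \<Longrightarrow> x * d \<in> D \<Longrightarrow> K_algebraic K x \<Longrightarrow> x \<in> K"
  shows "f \<in> ext K"
proof -
  interpret E: subfield "ext K" by standard (rule subfield_ext)
  have step: "f $$ n \<in> K" if IH: "\<And>m. m < n \<Longrightarrow> f $$ m \<in> K" for n
  proof (cases "f $$ n = 0")
    case False
    define e where "e = Abs_fls (\<lambda>m. if m < n then f $$ m else 0)"
    have e_nth: "e $$ m = (if m < n then f $$ m else 0)" for m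
      unfolding e_def by (rule nth_Abs_fls_lower_bound[of "fls_subdegree f"]) simp
    have e: "e \<in> ext K" using IH by (simp add: ext_def e_nth)
    define g where "g = f - e"
    have gn: "g $$ n = f $$ n" "\<And>m. m < n \<Longrightarrow> g $$ m = 0" by (auto simp: g_def e_nth)
    have sub: "fls_subdegree g = n" using gn False by (intro fls_subdegree_eqI) auto
    have g0: "g \<noteq> 0" using gn False by auto
    obtain p where p: "p \<in> polys (ext K)" "p \<noteq> 0" "poly p f = 0" using f unfolding K_algebraic_iff by blast
    \<comment> \<open>Substituting X + e turns an equation for \<open>f\<close> into one for f - e,
      still with coefficients in \<open>ext K\<close>.\<close>
    define q where "q = pcompose p [:e, 1:]"
    have "q \<in> polys (ext K)" unfolding q_def
      by (intro E.polys_pcompose p) (simp add: E.polys_pCons E.polys_0 e)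
    moreover have "q \<noteq> 0" using p(2) pcompose_eq_0[of p "[:e, 1:]"] by (auto simp: q_def)
    moreover have "poly q g = 0" using p(3) by (simp add: q_def poly_pcompose g_def)
    ultimately have alg: "K_algebraic K (f $$ n)" using algebraic_leading_coeff[OF _ _ _ g0] sub gn by metis
    have "e * v \<in> ext D" using ext_mult[OF D e v(1)] subspace_scale[OF D] by blast
    then have "g * v \<in> ext D"
      using v(3) subspace_diff[OF D] by (simp add: g_def left_diff_distrib ext_def)
    then have "(g * v) $$ (n + fls_subdegree v) \<in> D" by (rule extD)
    then have "f $$ n * v $$ fls_subdegree v \<in> D" using fls_times_base[of g v] sub gn by simp
    then show ?thesis using P[OF extD[OF v(1), of "fls_subdegree v"] _ _ alg] v(2) by simp
  qed simp
  have "f $$ (fls_subdegree f + int k) \<in> K" for k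
  proof (induction k rule: less_induct)
    case (less k)
    show ?case
    proof (rule step)
      fix m assume "m < fls_subdegree f + int k"
      show "f $$ m \<in> K"
      proof (cases "m < fls_subdegree f")
        case False
        then have "m = fls_subdegree f + int (nat (m - fls_subdegree f))" "nat (m - fls_subdegree f) < k"
          using \<open>m < _\<close> by auto
        then show ?thesis using less by metis
      qed simp
    qed
  qed
  moreover have "f $$ n = 0 \<or> n = fls_subdegree f + int (nat (n - fls_subdegree f))" for n
    by (cases "n < fls_subdegree f") auto
  ultimately have "f $$ n \<in> K" for n using zero_mem by metis
  then show ?thesis by (simp add: ext_def)
qed

text \<open>Choosing \<open>\<theta>\<close> such that \<open>C\<close> is spanned by as few elements as possible over \<open>adj K \<theta>\<close>, no
  larger simple extension creates new linear dependencies.\<close>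

lemma saturated_extension_exists:
  assumes prim: "\<And>\<alpha> \<beta>. K_algebraic K \<alpha> \<Longrightarrow> K_algebraic K \<beta> \<Longrightarrow>
      \<exists>\<gamma>. K_algebraic K \<gamma> \<and> \<alpha> \<in> adj K \<gamma> \<and> \<beta> \<in> adj K \<gamma>"
    and C: "fin_dim K C"
  obtains \<theta> where "K_algebraic K \<theta>"
    "\<And>x d. d \<in> K_span (adj K \<theta>) C \<Longrightarrow> d \<noteq> 0 \<Longrightarrow> x * d \<in> K_span (adj K \<theta>) C \<Longrightarrow>
      K_algebraic (adj K \<theta>) x \<Longrightarrow> x \<in> adj K \<theta>"
proof -
  define Q where "Q n \<longleftrightarrow> (\<exists>\<theta> X. K_algebraic K \<theta> \<and> finite X \<and> card X = n \<and> C \<subseteq> K_span (adj K \<theta>) X)" for n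
  obtain S where S: "finite S" "C \<subseteq> K_span K S" using C unfolding fin_dim_def by blast
  \<comment> \<open>\<theta> = 0 adjoins nothing and shows that some number of generators is
    possible.\<close>
  have "[:0, 1:] \<in> polys K" "[:0, 1:] \<noteq> (0 :: 'a poly)" "poly [:0, 1:] (0::'a) = 0"
    by (auto simp: polys_pCons polys_0)
  then have "K_algebraic K 0" unfolding K_algebraic_iff by blast
  then have "Q (card S)" unfolding Q_def using S span_restrict[OF subset_adj] by blast
  then obtain n where n: "Q n" "\<And>m. Q m \<Longrightarrow> n \<le> m" using LeastI[of Q] Least_le[of Q] by blast
  then obtain \<theta> X where \<theta>: "K_algebraic K \<theta>" and X: "finite X" "card X = n" "C \<subseteq> K_span (adj K \<theta>) X"
    unfolding Q_def by blast
  define E where "E = adj K \<theta>"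
  have E: "subfield_of E" "K \<subseteq> E" "fin_dim K E"
    unfolding E_def using subfield_adj[OF \<theta>] subset_adj fin_dim_adj[OF \<theta>] by auto
  interpret E: subfield E by standard (rule E)
  have "x \<in> E" if d: "d \<in> K_span E C" "d \<noteq> 0" "x * d \<in> K_span E C" and x: "K_algebraic E x" for x d
  proof (rule ccontr)
    assume "x \<notin> E"
    have CX: "K_span E C \<subseteq> K_span E X" using X(3) E.span_subset_span by (simp add: E_def)
    \<comment> \<open>Two of the \<open>n\<close> generators are exchanged for \<open>d\<close> and
      \<open>x * d\<close>, which are independent over \<open>E\<close> because \<open>x\<close> is
      not in \<open>E\<close>. Over a simple extension containing both \<open>E\<close> and
      \<open>x\<close>, the element \<open>d\<close> alone generates the two, so n - 1 generators
      would do, against minimality.\<close>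
    have "d \<in> K_span E ({} \<union> X)" "d \<notin> K_span E {}" using d CX E.span_empty by auto
    then obtain x0 where x0: "x0 \<in> X" "x0 \<in> K_span E (insert d (X - {x0}))"
      using E.span_exchange[OF X(1), of d "{}"] by auto
    have X1: "X \<subseteq> K_span E (insert d (X - {x0}))"
    proof
      fix y assume "y \<in> X"
      then show "y \<in> K_span E (insert d (X - {x0}))" using x0(2) by (cases "y = x0") (auto intro: E.span_base)
    qed
    have "x * d \<in> K_span E ({d} \<union> (X - {x0}))"
      using d(3) CX E.span_subset_span[OF X1] by auto
    moreover have "x * d \<notin> K_span E {d}"
      using d(2) \<open>x \<notin> E\<close> by (auto simp: E.span_insert E.span_empty)
    ultimately obtain x1 where x1: "x1 \<in> X - {x0}" "x1 \<in> K_span E (insert (x * d) ({d} \<union> (X - {x0} - {x1})))"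
      using E.span_exchange[of "X - {x0}" "x * d" "{d}"] X(1) by auto
    have "K_algebraic K x" using algebraic_trans[OF E x] .
    then obtain \<gamma> where \<gamma>: "K_algebraic K \<gamma>" "\<theta> \<in> adj K \<gamma>" "x \<in> adj K \<gamma>" using prim[OF \<theta>] by blast
    define F where "F = adj K \<gamma>"
    have F: "subfield_of F" "K \<subseteq> F" using subfield_adj[OF \<gamma>(1)] subset_adj by (auto simp: F_def)
    interpret F: subfield F by standard (rule F)
    have EF: "E \<subseteq> F" unfolding E_def using adj_subset[OF F] \<gamma> by (simp add: F_def)
    define Y where "Y = insert d (X - {x0} - {x1})"
    have "d \<in> K_span F Y" by (rule F.span_base) (simp add: Y_def)
    then have "x * d \<in> K_span F Y" using \<gamma>(3) F.subspace_scale[OF F.subspace_span] by (simp add: F_def)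
    then have "insert (x * d) ({d} \<union> (X - {x0} - {x1})) \<subseteq> K_span F Y"
      using F.span_superset[of Y] by (auto simp: Y_def)
    then have x1F: "x1 \<in> K_span F Y"
      using x1(2) span_restrict[OF EF] F.span_subset_span by blast
    have "insert d (X - {x0}) \<subseteq> K_span F Y"
    proof
      fix y assume "y \<in> insert d (X - {x0})"
      then show "y \<in> K_span F Y" using x1F by (cases "y = x1") (auto intro: F.span_base simp: Y_def)
    qed
    then have "X \<subseteq> K_span F Y" using X1 span_restrict[OF EF] F.span_subset_span by blast
    then have "C \<subseteq> K_span F Y" using X(3) span_restrict[OF EF] F.span_subset_span unfolding E_def by blast
    moreover have "finite Y" using X(1) by (simp add: Y_def)
    ultimately have "Q (card Y)" unfolding Q_def F_def using \<gamma>(1) by blast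
    then have "n \<le> card Y" by (rule n)
    moreover have "card Y \<le> Suc (card (X - {x0} - {x1}))" unfolding Y_def by (rule card_insert_le_m1) auto
    moreover have "Suc (Suc (card (X - {x0} - {x1}))) = n"
      using X x0(1) x1(1) by (metis card.remove finite_Diff)
    ultimately show False by simp
  qed
  then show ?thesis using that[OF \<theta>] unfolding E_def by blast
qed

text \<open>As \<open>H\<close> carries some nonzero \<open>v\<close> into \<open>ext C\<close>, it
  is finite-dimensional over \<open>ext K\<close> and so algebraic. The saturation property of E =
  \<open>adj K \<theta>\<close>, transferred to series by \<open>mem_ext_if_leading_coeffs\<close>,
  puts \<open>H\<close> inside \<open>ext E\<close>. The latter is spanned over \<open>ext K\<close>
  by powers of the constant \<theta>, which leads to \<open>finite_subfields_adj\<close>.\<close>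

lemma finite_stabilizing_subfields:
  assumes prim: "\<And>\<alpha> \<beta>. K_algebraic K \<alpha> \<Longrightarrow> K_algebraic K \<beta> \<Longrightarrow>
      \<exists>\<gamma>. K_algebraic K \<gamma> \<and> \<alpha> \<in> adj K \<gamma> \<and> \<beta> \<in> adj K \<gamma>"
    and C: "fin_dim K C"
  shows "finite {H. subfield_of H \<and> ext K \<subseteq> H \<and> (\<exists>v\<in>ext C. v \<noteq> 0 \<and> (\<forall>h\<in>H. h * v \<in> ext C))}"
    (is "finite ?HH")
proof -
  interpret L: subfield "ext K" by standard (rule subfield_ext)
  obtain \<theta> where \<theta>: "K_algebraic K \<theta>"
    "\<And>x d. d \<in> K_span (adj K \<theta>) C \<Longrightarrow> d \<noteq> 0 \<Longrightarrow> x * d \<in> K_span (adj K \<theta>) C \<Longrightarrow>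
      K_algebraic (adj K \<theta>) x \<Longrightarrow> x \<in> adj K \<theta>"
    using saturated_extension_exists[OF prim C] by blast
  define E where "E = adj K \<theta>"
  have E: "subfield_of E" "K \<subseteq> E"
    unfolding E_def using subfield_adj[OF \<theta>(1)] subset_adj by auto
  interpret E: subfield E by standard (rule E)
  define D where "D = K_span E C"
  obtain p where p: "p \<in> polys K" "p \<noteq> 0" "poly p \<theta> = 0" using \<theta>(1) unfolding K_algebraic_iff by blast
  have extE: "ext E \<subseteq> adj (ext K) (fls_const \<theta>)"
  proof -
    have "ext E = K_span (ext K) (fls_const ` (\<lambda>i. \<theta> ^ i) ` {..<degree p})"
      unfolding E_def adj_eq_span[OF p] by (rule ext_span) simp
    moreover have "fls_const (\<theta> ^ i) \<in> adj (ext K) (fls_const \<theta>)" for i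
    proof (induction i)
      case 0
      then show ?case using subsetD[OF L.subset_adj L.one_mem] by simp
    next
      case (Suc i)
      then show ?case using L.adj_mult[OF L.mem_adj Suc] by simp
    qed
    then have "fls_const ` (\<lambda>i. \<theta> ^ i) ` {..<degree p} \<subseteq> adj (ext K) (fls_const \<theta>)" by auto
    ultimately show ?thesis using L.span_minimal[OF L.subspace_adj] by metis
  qed
  have "?HH \<subseteq> {H. subfield_of H \<and> ext K \<subseteq> H \<and> H \<subseteq> adj (ext K) (fls_const \<theta>)}"
  proof clarify
    fix H v f assume H: "subfield_of H" "ext K \<subseteq> H" and v: "v \<in> ext C" "v \<noteq> 0" "\<forall>h\<in>H. h * v \<in> ext C"
      and f: "f \<in> H"
    have "fin_dim (ext K) H"
      using L.fin_dim_multiplier[OF fin_dim_ext[OF C] L.subspace_extension[OF H] v(2)] v(3) by blast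
    then have "K_algebraic (ext K) f" using L.algebraic_if_mem H f by blast
    then have "K_algebraic (ext E) f" using K_algebraic_mono ext_mono[OF E(2)] by blast
    moreover have "ext C \<subseteq> ext D" using E.span_superset by (intro ext_mono) (auto simp: D_def)
    ultimately have "f \<in> ext E"
      using v f \<theta>(2) E.subspace_span
      by (intro E.mem_ext_if_leading_coeffs[of D f v]) (auto simp: D_def E_def)
    then show "f \<in> adj (ext K) (fls_const \<theta>)" using extE by blast
  qed
  moreover have "finite {H. subfield_of H \<and> ext K \<subseteq> H \<and> H \<subseteq> adj (ext K) (fls_const \<theta>)}"
  proof (rule L.finite_subfields_adj)
    show "map_poly fls_const p \<in> polys (ext K)"
      using p(1) by (auto simp: polys_def coeff_map_poly const_mem_ext)
    show "map_poly fls_const p \<noteq> 0" using p(2) by (simp add: map_poly_eq_0_iff)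
    have "poly (map_poly fls_const p) (fls_const \<theta>) = fls_const (poly p \<theta>)"
      by (induction p) (simp_all add: map_poly_pCons fls_plus_const[symmetric])
    then show "poly (map_poly fls_const p) (fls_const \<theta>) = 0" using p(3) by simp
  qed
  ultimately show ?thesis using finite_subset by blast
qed

theorem kneser:
  assumes sep: "\<forall>x. K_algebraic K x \<longrightarrow> K_separable K x"
    and A: "fin_dim K A" "A \<noteq> {0}" and B: "fin_dim K B" "B \<noteq> {0}"
  shows "kdim K A + kdim K B \<le> kdim K (prod_span K A B) + kdim K (stab (prod_span K A B))"
proof -
  interpret L: subfield "ext K" by standard (rule subfield_ext)
  define C where "C = prod_span K A B"
  have C: "fin_dim K C" unfolding C_def using fin_dim_prod_span A B by blast
  have sA: "0 \<in> A" and sB: "0 \<in> B" and sC: "0 \<in> C"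
    using A B C subspace_zero unfolding fin_dim_def by blast+
  obtain a b where ab: "a \<in> A" "a \<noteq> 0" "b \<in> B" "b \<noteq> 0" using A B sA sB by blast
  \<comment> \<open>A nonzero element of \<open>C\<close> is what makes the stabilizer
    finite-dimensional; the stabilizer of {0} is the whole field.\<close>
  have "a * b \<in> C" "a * b \<noteq> 0" unfolding C_def using ab prod_span_base by auto
  note stabC = fin_dim_stab[OF C this]
  have ne: "ext A \<noteq> {0}" "ext B \<noteq> {0}"
    using const_mem_ext[OF sA, of a] const_mem_ext[OF sB, of b] ab by (metis fls_const_eq_0_iff singletonD)+
  have eq: "prod_span (ext K) (ext A) (ext B) = ext C"
    unfolding C_def using prod_span_ext A B by blast
  have "kdim (ext K) (ext A) + kdim (ext K) (ext B) \<le> kdim (ext K) (ext C) + kdim (ext K) (stab (ext C))"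
    using L.kneser_infinite[OF infinite_ext fin_dim_ext[OF A(1)] ne(1) fin_dim_ext[OF B(1)] ne(2)]
      finite_stabilizing_subfields[OF primitive_element[OF sep] C] unfolding eq by blast
  moreover have "kdim (ext K) (stab (ext C)) \<le> kdim (ext K) (ext (stab C))"
    using L.subspace_stab[OF L.fin_dim_subspace[OF fin_dim_ext[OF C]]]
    by (intro L.kdim_mono fin_dim_ext stabC stab_ext_subset[OF sC])
  ultimately show ?thesis
    using kdim_ext[OF A(1)] kdim_ext[OF B(1)] kdim_ext[OF C] kdim_ext[OF stabC] by (simp add: C_def)
qed

end

subsection \<open>The bounds\<close>

lemma ceiling_div_le:
  fixes r h a :: nat
  assumes "0 < h" "r \<le> h * a"
  shows "(r + h - 1) div h \<le> a"
proof -
  have "r + h - 1 < Suc a * h" using assms by (simp add: mult.commute)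
  then have "(r + h - 1) div h < Suc a" by (rule less_mult_imp_div_less)
  then show ?thesis by simp
qed

lemma le_mult_ceiling_div:
  fixes r h :: nat
  assumes "0 < h"
  shows "r \<le> h * ((r + h - 1) div h)"
proof -
  have "h * ((r + h - 1) div h) + (r + h - 1) mod h = r + h - 1" by simp
  moreover have "(r + h - 1) mod h < h" using assms by simp
  ultimately show ?thesis by linarith
qed

lemma ceiling_div_pos: "0 < h \<Longrightarrow> 0 < r \<Longrightarrow> 0 < (r + h - 1) div (h::nat)"
  by (simp add: div_greater_zero_iff)

context subfield
begin

lemma intermediate_degreesE:
  assumes "h \<in> intermediate_degrees K"
  obtains H where "subfield_of H" "K \<subseteq> H" "fin_dim K H" "kdim K H = h" "0 < h"
proof -
  obtain H where H: "subfield_of H" "K \<subseteq> H" "fin_dim K H" "kdim K H = h"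
    using assms unfolding intermediate_degrees_def K_dim_eq_enat_iff by blast
  moreover have "0 < h" using kdim_pos[OF H(3), of 1] H by (auto simp: subfield_of_def)
  ultimately show ?thesis using that by blast
qed

lemma intermediate_degrees_nonempty: "intermediate_degrees K \<noteq> {}"
proof -
  have "K \<subseteq> K_span K {1}"
    by (auto simp: span_insert span_empty)
  then have "fin_dim K K" unfolding fin_dim_def using subspace_self by blast
  then have "kdim K K \<in> intermediate_degrees K"
    unfolding intermediate_degrees_def K_dim_eq_enat_iff using subfield by blast
  then show ?thesis by blast
qed

lemma subspace_of_kdim:
  assumes "fin_dim K A" "r \<le> kdim K A"
  obtains A' where "A' \<subseteq> A" "fin_dim K A'" "kdim K A' = r"
proof -
  obtain X where X: "finite X" "K_basis K A X" "card X = kdim K A" by (rule basis_exists[OF assms(1)])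
  then obtain Y where Y: "Y \<subseteq> X" "card Y = r" "finite Y"
    using obtain_subset_with_card_n[of r X] assms(2) by metis
  have "K_independent K Y" using X(2) Y(1) independent_mono unfolding K_basis_def by blast
  then have "K_basis K (K_span K Y) Y" unfolding K_basis_def using span_superset by blast
  then have "kdim K (K_span K Y) = r" using kdim_eq_card[OF Y(3)] Y(2) by simp
  moreover have "K_span K Y \<subseteq> A" using X(2) span_mono[OF Y(1)] unfolding K_basis_def by blast
  ultimately show ?thesis using that fin_dim_span[OF Y(3)] by blast
qed

text \<open>Kneser's inequality is applied to the spans of A and B over H = \<open>stab C\<close>.
  The product span is still C, while the dimensions become h a' and h b' with a' and b' at least the
  ceilings of dim A / h and dim B / h. Thus h (a' + b') is at most dim C + h, and dim C is at least
  the term of \<open>kappa\<close> belonging to h.\<close>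

lemma prod_span_lower_bound:
  assumes sep: "\<forall>x. K_algebraic K x \<longrightarrow> K_separable K x"
    and A: "fin_dim K A" "0 < kdim K A" and B: "fin_dim K B" "0 < kdim K B"
  shows "kappa K (kdim K A) (kdim K B) \<le> kdim K (prod_span K A B)"
proof -
  define C where "C = prod_span K A B"
  have C: "fin_dim K C" unfolding C_def using fin_dim_prod_span A B by blast
  have "A \<noteq> {0}" "B \<noteq> {0}" using A B kdim_zero by auto
  moreover have "0 \<in> A" "0 \<in> B" using A B subspace_zero unfolding fin_dim_def by blast+
  ultimately obtain a b where ab: "a \<in> A" "a \<noteq> 0" "b \<in> B" "b \<noteq> 0" by blast
  have v: "a * b \<in> C" "a * b \<noteq> 0" unfolding C_def using ab prod_span_base by auto
  define H where "H = stab C"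
  define h where "h = kdim K H"
  have H: "subfield_of H" "K \<subseteq> H" "fin_dim K H"
    unfolding H_def using subfield_stab[OF C v] subset_stab[OF C v] fin_dim_stab[OF C v] by auto
  interpret H: subfield H by standard (rule H)
  have h: "h \<in> intermediate_degrees K" "0 < h"
    using H kdim_pos[OF H(3) H.one_mem] unfolding h_def intermediate_degrees_def K_dim_eq_enat_iff by auto
  have HC: "K_subspace H C"
    using subspace_zero[OF fin_dim_subspace[OF C]] subspace_add[OF fin_dim_subspace[OF C]]
    by (auto simp: K_subspace_def H_def stab_def)
  have *: "fin_dim K (K_span H X)" "kdim K (K_span H X) = h * kdim H (K_span H X)"
      "X \<subseteq> K_span H X" "(kdim K X + h - 1) div h \<le> kdim H (K_span H X)" if X: "fin_dim K X" for X
  proof -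
    obtain S where "finite S" "X \<subseteq> K_span K S" using X unfolding fin_dim_def by blast
    then have "fin_dim H (K_span H X)"
      using H.span_subset_span[of X S] span_restrict[OF H(2), of S] H.subspace_span
      unfolding fin_dim_def by blast
    then show 1: "fin_dim K (K_span H X)" "kdim K (K_span H X) = h * kdim H (K_span H X)"
      using fin_dim_tower[OF H] kdim_tower[OF H] by (auto simp: h_def)
    show "X \<subseteq> K_span H X" by (rule H.span_superset)
    then have "kdim K X \<le> kdim K (K_span H X)" using kdim_mono[OF 1(1) fin_dim_subspace[OF X]] by blast
    then show "(kdim K X + h - 1) div h \<le> kdim H (K_span H X)" using ceiling_div_le[OF h(2)] 1(2) by simp
  qed
  define A1 where "A1 = K_span H A"
  define B1 where "B1 = K_span H B"
  have "A1 \<subseteq> {x. x * y \<in> C}" if "y \<in> B" for y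
    unfolding A1_def using prod_span_base that
    by (intro H.span_minimal H.subspace_preimage_mult HC) (auto simp: C_def)
  then have "B1 \<subseteq> {y. y * x \<in> C}" if "x \<in> A1" for x
    unfolding B1_def using that
    by (intro H.span_minimal H.subspace_preimage_mult HC) (auto simp: mult.commute)
  then have "prod_span K A1 B1 \<subseteq> C"
    by (intro prod_span_minimal fin_dim_subspace[OF C]) (auto simp: mult.commute)
  moreover have "C \<subseteq> prod_span K A1 B1"
    unfolding C_def using *(3)[OF A(1)] *(3)[OF B(1)]
    by (intro prod_span_minimal subspace_prod_span prod_span_base) (auto simp: A1_def B1_def)
  ultimately have C1: "prod_span K A1 B1 = C" by blast
  have "A1 \<noteq> {0}" "B1 \<noteq> {0}" using *(3)[OF A(1)] *(3)[OF B(1)] ab by (auto simp: A1_def B1_def)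
  then have "kdim K A1 + kdim K B1 \<le> kdim K C + h"
    using kneser[OF sep, of A1 B1] *(1)[OF A(1)] *(1)[OF B(1)] C1 by (simp add: A1_def B1_def h_def H_def)
  then have "(kdim H A1 + kdim H B1) * h \<le> kdim K C + h"
    using *(2)[OF A(1)] *(2)[OF B(1)] by (simp add: A1_def B1_def algebra_simps)
  then have le: "(kdim H A1 + kdim H B1 - 1) * h \<le> kdim K C" by (simp add: diff_mult_distrib)
  have "kappa K (kdim K A) (kdim K B)
      \<le> ((kdim K A + h - 1) div h + (kdim K B + h - 1) div h - 1) * h"
    unfolding kappa_def using h(1) by (intro cInf_lower) auto
  also have "\<dots> \<le> (kdim H A1 + kdim H B1 - 1) * h"
    using *(4)[OF A(1)] *(4)[OF B(1)] by (intro mult_le_mono1 diff_le_mono add_mono) (auto simp: A1_def B1_def)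
  finally show ?thesis using le by (simp add: C_def)
qed

text \<open>Suppose every element has degree at most m - 1 over \<open>H\<close>. Then all simple
  extensions of \<open>K\<close> have bounded dimension, and one of largest dimension contains every
  \<beta>, because \<theta> and \<beta> lie in a common simple extension. So it is all of L, whose
  dimension is then too small. The negated form of \<open>big\<close> also covers
  infinite-dimensional L.\<close>

lemma large_degree_element_exists:
  assumes sep: "\<forall>x. K_algebraic K x \<longrightarrow> K_separable K x"
    and H: "subfield_of H" "K \<subseteq> H" "fin_dim K H"
    and big: "\<not> (fin_dim K UNIV \<and> kdim K UNIV \<le> kdim K H * (m - 1))"
  shows "\<exists>\<theta>. \<forall>p\<in>polys H. p \<noteq> 0 \<and> degree p < m \<longrightarrow> poly p \<theta> \<noteq> 0"
proof (rule ccontr)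
  assume no: "\<not> ?thesis"
  interpret H: subfield H by standard (rule H)
  have alg: "K_algebraic K \<theta>" and le: "kdim K (adj K \<theta>) \<le> kdim K H * (m - 1)" for \<theta>
  proof -
    obtain p where p: "p \<in> polys H" "p \<noteq> 0" "degree p < m" "poly p \<theta> = 0" using no by blast
    then have H\<theta>: "K_algebraic H \<theta>" unfolding K_algebraic_iff by blast
    show "K_algebraic K \<theta>" by (rule algebraic_trans[OF H H\<theta>])
    have fin: "fin_dim K (adj H \<theta>)" by (rule fin_dim_tower[OF H H.fin_dim_adj[OF H\<theta>]])
    have "kdim K (adj K \<theta>) \<le> kdim K (adj H \<theta>)"
      by (rule kdim_mono[OF fin subspace_adj adj_mono[OF H(2)]])
    also have "\<dots> = kdim K H * kdim H (adj H \<theta>)" by (rule kdim_tower[OF H H.fin_dim_adj[OF H\<theta>]])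
    also have "\<dots> \<le> kdim K H * (m - 1)" using H.kdim_adj_le[OF p(1,2,4)] p(3) by (intro mult_le_mono2) simp
    finally show "kdim K (adj K \<theta>) \<le> kdim K H * (m - 1)" .
  qed
  obtain \<theta> where \<theta>: "\<And>\<gamma>. kdim K (adj K \<gamma>) \<le> kdim K (adj K \<theta>)"
  proof -
    have "\<exists>\<theta>. True \<and> (\<forall>\<gamma>. True \<longrightarrow> kdim K (adj K \<gamma>) \<le> kdim K (adj K \<theta>))"
      using le by (intro ex_has_greatest_nat[of _ undefined _ "Suc (kdim K H * (m - 1))"]) (auto simp: less_Suc_eq_le le_SucI)
    then show ?thesis using that by blast
  qed
  have "\<beta> \<in> adj K \<theta>" for \<beta>
  proof -
    obtain \<gamma> where \<gamma>: "\<theta> \<in> adj K \<gamma>" "\<beta> \<in> adj K \<gamma>" using primitive_element[OF sep alg alg] by blast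
    have "adj K \<theta> \<subseteq> adj K \<gamma>" by (rule adj_subset[OF subfield_adj[OF alg] subset_adj \<gamma>(1)])
    then have "adj K \<theta> = adj K \<gamma>" by (rule subspace_eq_if_kdim_le[OF fin_dim_adj[OF alg] subspace_adj _ \<theta>])
    then show ?thesis using \<gamma>(2) by simp
  qed
  then have "adj K \<theta> = UNIV" by blast
  then show False using big fin_dim_adj[OF alg, of \<theta>] le[of \<theta>] by simp
qed

text \<open>The analogue of adding two arithmetic progressions: with r' and s' the ceilings of r/h
  and s/h, the \<open>H\<close>-spans of the first r' and the first s' powers of \<theta> multiply
  into the span of the first r' + s' - 1 powers. \<open>A\<close> and \<open>B\<close> are subspaces
  of these spans, cut down to the exact dimensions.\<close>

lemma prod_span_upper_bound:
  assumes sep: "\<forall>x. K_algebraic K x \<longrightarrow> K_separable K x"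
    and rs: "0 < r" "0 < s" "enat r \<le> K_dim K UNIV" "enat s \<le> K_dim K UNIV"
    and h: "h \<in> intermediate_degrees K"
  shows "\<exists>A B. fin_dim K A \<and> fin_dim K B \<and> kdim K A = r \<and> kdim K B = s \<and> fin_dim K (prod_span K A B) \<and>
    kdim K (prod_span K A B) \<le> ((r + h - 1) div h + (s + h - 1) div h - 1) * h"
proof -
  obtain H where H: "subfield_of H" "K \<subseteq> H" "fin_dim K H" and kH: "kdim K H = h" and h0: "0 < h"
    using intermediate_degreesE[OF h] by blast
  interpret H: subfield H by standard (rule H)
  define r' where "r' = (r + h - 1) div h"
  define s' where "s' = (s + h - 1) div h"
  \<comment> \<open>Independence of powers is required up to the longer progression only; for the
    product an upper bound on the dimension suffices.\<close>
  define m where "m = max r' s'"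
  have pos: "0 < r'" "0 < s'" using ceiling_div_pos h0 rs by (auto simp: r'_def s'_def)
  have lt: "h * (r' - 1) < r" "h * (s' - 1) < s"
  proof -
    have "\<not> r \<le> h * (r' - 1)" "\<not> s \<le> h * (s' - 1)"
      using ceiling_div_le[OF h0, of r "r' - 1"] ceiling_div_le[OF h0, of s "s' - 1"] pos
      by (auto simp: r'_def s'_def)
    then show "h * (r' - 1) < r" "h * (s' - 1) < s" by auto
  qed
  \<comment> \<open>By minimality of the ceilings, h (m - 1) is less than r or less than s, and both
    are at most dim L.\<close>
  have "\<not> (fin_dim K UNIV \<and> kdim K UNIV \<le> kdim K H * (m - 1))"
  proof
    assume u: "fin_dim K UNIV \<and> kdim K UNIV \<le> kdim K H * (m - 1)"
    then have "K_dim K UNIV = enat (kdim K UNIV)" using K_dim_eq_enat_iff by blast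
    then have "r \<le> h * (m - 1)" "s \<le> h * (m - 1)" using rs u kH by auto
    then show False using lt unfolding m_def max_def by (auto split: if_splits)
  qed
  then obtain \<theta> where \<theta>: "\<forall>p\<in>polys H. p \<noteq> 0 \<and> degree p < m \<longrightarrow> poly p \<theta> \<noteq> 0"
    using large_degree_element_exists[OF sep H] by blast
  define X where "X n = (\<lambda>i. \<theta> ^ i) ` {..<n}" for n
  have X: "fin_dim K (K_span H (X n))" "kdim K (K_span H (X n)) = h * n" if "n \<le> m" for n
  proof -
    have "K_independent H (X n)" "card (X n) = n"
      using H.independent_powers[of n \<theta> 1] \<theta> that by (auto simp: X_def)
    moreover have "finite (X n)" by (simp add: X_def)
    ultimately show "fin_dim K (K_span H (X n))" "kdim K (K_span H (X n)) = h * n"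
      using fin_dim_span_extension[OF H] kdim_span_extension[OF H] kH by auto
  qed
  have m: "r' \<le> m" "s' \<le> m" by (auto simp: m_def)
  obtain A where A: "A \<subseteq> K_span H (X r')" "fin_dim K A" "kdim K A = r"
    using subspace_of_kdim[OF X(1)[OF m(1)], of r] X(2)[OF m(1)] le_mult_ceiling_div[OF h0, of r]
    by (auto simp: r'_def)
  obtain B where B: "B \<subseteq> K_span H (X s')" "fin_dim K B" "kdim K B = s"
    using subspace_of_kdim[OF X(1)[OF m(2)], of s] X(2)[OF m(2)] le_mult_ceiling_div[OF h0, of s]
    by (auto simp: s'_def)
  define D where "D = K_span H (X (r' + s' - 1))"
  have finX: "finite (X (r' + s' - 1))" by (simp add: X_def)
  have fD: "fin_dim H D" unfolding D_def by (rule H.fin_dim_span[OF finX])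
  have "{x * y |x y. x \<in> X r' \<and> y \<in> X s'} \<subseteq> X (r' + s' - 1)"
  proof clarify
    fix x y assume "x \<in> X r'" "y \<in> X s'"
    then obtain i j where "x = \<theta> ^ i" "i < r'" "y = \<theta> ^ j" "j < s'" by (auto simp: X_def)
    then show "x * y \<in> X (r' + s' - 1)"
      unfolding X_def by (intro image_eqI[of _ _ "i + j"]) (auto simp: power_add)
  qed
  then have "prod_span H (K_span H (X r')) (K_span H (X s')) \<subseteq> D"
    unfolding D_def H.prod_span_spans by (rule H.span_mono)
  then have "prod_span K A B \<subseteq> D"
    using A(1) B(1) H.prod_span_base[of _ "K_span H (X r')" _ "K_span H (X s')"]
    by (intro prod_span_minimal fin_dim_subspace[OF fin_dim_tower[OF H fD]]) blast
  then have "kdim K (prod_span K A B) \<le> kdim K D"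
    by (rule kdim_mono[OF fin_dim_tower[OF H fD] subspace_prod_span])
  also have "\<dots> = h * kdim H D" using kdim_tower[OF H fD] kH by simp
  also have "\<dots> \<le> h * (r' + s' - 1)"
  proof (rule mult_le_mono2)
    have "kdim H D \<le> card (X (r' + s' - 1))" unfolding D_def by (rule H.kdim_span_le[OF finX])
    also have "\<dots> \<le> r' + s' - 1" unfolding X_def using card_image_le[of "{..<r' + s' - 1}"] by simp
    finally show "kdim H D \<le> r' + s' - 1" .
  qed
  finally have "kdim K (prod_span K A B) \<le> (r' + s' - 1) * h" by (simp add: mult.commute)
  then show ?thesis using A B fin_dim_prod_span[OF A(2) B(2)] unfolding r'_def s'_def by blast
qed

end

theorem theorem1p1:
  fixes K :: "'a::field set" and r s :: nat
  assumes "subfield_of K"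
    and "\<forall>x. K_algebraic K x \<longrightarrow> K_separable K x"
    and "0 < r" and "0 < s"
    and "enat r \<le> K_dim K UNIV" and "enat s \<le> K_dim K UNIV"
  shows "mu K r s = enat (kappa K r s)"
proof (rule antisym)
  interpret subfield K by standard (rule assms(1))
  \<comment> \<open>The infimum over a nonempty set of natural numbers is attained, so a single
    degree \<open>h\<close> realizes \<open>kappa\<close>.\<close>
  have "kappa K r s \<in> (\<lambda>h. ((r + h - 1) div h + (s + h - 1) div h - 1) * h) ` intermediate_degrees K"
    unfolding kappa_def using intermediate_degrees_nonempty by (intro Inf_nat_def1) auto
  then obtain h where h: "h \<in> intermediate_degrees K"
    "kappa K r s = ((r + h - 1) div h + (s + h - 1) div h - 1) * h" by blast
  obtain A B where AB: "fin_dim K A" "fin_dim K B" "kdim K A = r" "kdim K B = s" "fin_dim K (prod_span K A B)"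
    "kdim K (prod_span K A B) \<le> kappa K r s"
    using prod_span_upper_bound[OF assms(2-6) h(1)] h(2) by auto
  then have "mu K r s \<le> K_dim K (prod_span K A B)"
    unfolding mu_def using K_dim_eq_enat_iff fin_dim_subspace by (intro Inf_lower) blast
  also have "\<dots> = enat (kdim K (prod_span K A B))" using AB(5) K_dim_eq_enat_iff by blast
  also have "\<dots> \<le> enat (kappa K r s)" using AB(6) by simp
  finally show "mu K r s \<le> enat (kappa K r s)" .
  show "enat (kappa K r s) \<le> mu K r s"
    unfolding mu_def
  proof (rule Inf_greatest, clarify)
    fix A B assume "K_dim K A = enat r" "K_dim K B = enat s"
    then have AB: "fin_dim K A" "kdim K A = r" "fin_dim K B" "kdim K B = s"
      using K_dim_eq_enat_iff by blast+
    then have "K_dim K (prod_span K A B) = enat (kdim K (prod_span K A B))"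
      using K_dim_eq_enat_iff fin_dim_prod_span by blast
    then show "enat (kappa K r s) \<le> K_dim K (prod_span K A B)"
      using prod_span_lower_bound[OF assms(2) AB(1) _ AB(3)] AB assms(3,4) by simp
  qed
qed

end
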